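(* Let $\mathcal{S}=(A,B,C,\mathcal{N},\mathcal{M})$ be a BQO system of order $n$ and $\widehat{\mathcal{S}}=(\widehat A,\widehat B,\widehat C,\widehat{\mathcal{N}},\widehat{\mathcal{M}})$ a BQO system of order $r$, both with $m$ inputs and $p$ outputs, with $A,\widehat A$ stable with stability parameters $\alpha,\beta$ and $\widehat\alpha,\widehat\beta$, and with $\|\mathcal{N}\|^2,\|\mathcal{N}_T\|^2<2\alpha/\beta^2$ and $\|\widehat{\mathcal{N}}\|^2,\|\widehat{\mathcal{N}}_T\|^2<2\widehat\alpha/\widehat\beta^2$. Assume that $\widehat{\mathcal{S}}$ is locally $\mathcal{H}_2$ optimal for $\mathcal{S}$. Let $\widehat P\in\mathbb{R}^{r\times r}$ and $X\in\mathbb{R}^{n\times r}$ be the unique solutions of $$\widehat A\widehat P+\widehat P\widehat A^T+\sum_{k=1}^m\widehat N_k\widehat P\widehat N_k^T+\widehat B\widehat B^T=0,\qquad AX+X\widehat A^T+\sum_{k=1}^mN_kX\widehat N_k^T+B\widehat B^T=0,$$ and let $\Psi=\Psi^T\in\mathbb{R}^{r\times r}$ and $\Pi\in\mathbb{R}^{n\times r}$ be the unique solutions of $$\widehat A^T\Psi+\Psi\widehat A+\sum_{k=1}^m\widehat N_k^T\Psi\widehat N_k+2\sum_{j=1}^p\widehat M_j\widehat P\widehat M_j+\widehat C^T\widehat C=0,$$ $$A^T\Pi+\Pi\widehat A+\sum_{k=1}^mN_k^T\Pi\widehat N_k+2\sum_{j=1}^pM_jX\widehat M_j+C^T\widehat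 C=0.$$ Then, for all $k=1,\dots,m$ and $j=1,\dots,p$, $$0=\Psi\widehat P-\Pi^TX,\quad 0=\Psi\widehat B-\Pi^TB,\quad 0=\Psi\widehat N_k\widehat P-\Pi^TN_kX,\quad 0=\widehat C\widehat P-CX,\quad 0=\widehat P\widehat M_j\widehat P-X^TM_jX.$$
   Context: A BQO (bilinear quadratic output) system of order $n$ with $m$ inputs and $p$ outputs is given by real matrices $A\in\mathbb{R}^{n\times n}$, $B\in\mathbb{R}^{n\times m}$, $C\in\mathbb{R}^{p\times n}$, $N_1,\dots,N_m\in\mathbb{R}^{n\times n}$ and symmetric $M_1,\dots,M_p\in\mathbb{R}^{n\times n}$, and represents $\dot x=Ax+\sum_kN_kxu_k+Bu$, $x(0)=0$, $y=Cx+[x^TM_1x,\dots,x^TM_px]^T$. Write $\mathcal{N}=[N_1\,\dots\,N_m]$, $\mathcal{M}=[M_1\,\dots\,M_p]$, $\mathcal{N}_T=[N_1^T\,\dots\,N_m^T]$, $\mathfrak{M}=[\operatorname{vec}(M_1)\,\dots\,\operatorname{vec}(M_p)]^T$. Hatted quantities denote the analogous objects of $\widehat{\mathcal{S}}$ (order $r$, $\widehat M_j$ symmetric). $\|\cdot\|$ is the spectral norm. $A$ is stable if all its eigenvalues have negative real part; stability parameters are constants $\beta>0$, $0<\alpha\le-\max_i\operatorname{Re}(\lambda_i(A))$ with $\|e^{At}\|\le\beta e^{-\alpha t}$ for all $t\ge0$ (similarly $\widehat\alpha,\widehat\beta$ for $\widehat A$). $\mathcal{H}_2$ norm of a BQO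 system: let $\bar P_1(t_1)=e^{At_1}B$ and $\bar P_i(t_1,\dots,t_i)=e^{At_i}\mathcal{N}(I_m\otimes\bar P_{i-1}(t_1,\dots,t_{i-1}))$ for $i\ge2$; $h_{C,i}=C\bar P_i(t_1,\dots,t_i)$, $h_{M,i,j}=\mathfrak{M}(\bar P_i(t_1,\dots,t_i)\otimes\bar P_j(\bar t_1,\dots,\bar t_j))$. Then $$\|\mathcal{S}\|_{\mathcal{H}_2}^2=\sum_{i=1}^\infty\int_0^\infty\!\!\cdots\!\int_0^\infty\|h_{C,i}\|_F^2\,dt_1\cdots dt_i+\sum_{i,j=1}^\infty\int_0^\infty\!\!\cdots\!\int_0^\infty\|h_{M,i,j}\|_F^2\,dt_1\cdots dt_i\,d\bar t_1\cdots d\bar t_j.$$ $\mathcal{S}-\widehat{\mathcal{S}}$ denotes the error system, i.e. the BQO system of order $n+r$ with matrices $\operatorname{diag}(A,\widehat A)$, $\begin{bmatrix}B\\\widehat B\end{bmatrix}$, $[C\ \ -\widehat C]$, $\operatorname{diag}(N_k,\widehat N_k)$, $\operatorname{diag}(M_j,-\widehat M_j)$. $\widehat{\mathcal{S}}$ is locally $\mathcal{H}_2$ optimal for $\mathcal{S}$ if its matrices $(\widehat A,\widehat B,\widehat C,\widehat N_1,\dots,\widehat N_m,\widehat M_1,\dots,\widehat M_p)$ are a local minimizer of the error $\|\mathcal{S}-\widehat{\mathcal{S}}\|_{\mathcal{H}_2}^2$ over BQO systems of order $r$ (with the same $m,p$). *)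

theory Defs
  imports "HOL-Analysis.Analysis"
begin

section \<open>Matrices\<close>

text \<open>Block row \<open>[N\<^sub>1 \<dots> N\<^sub>m]\<close>: column \<open>(k, b)\<close> is column \<open>b\<close> of block \<open>k\<close>.\<close>

definition hcat :: "real ^ 'b ^ 'a ^ 'k \<Rightarrow> real ^ ('k \<times> 'b) ^ 'a" where
  "hcat N = (\<chi> a kb. N $ fst kb $ a $ snd kb)"

definition transposes :: "real ^ 'b ^ 'a ^ 'k \<Rightarrow> real ^ 'a ^ 'b ^ 'k" where
  "transposes N = (\<chi> k. transpose (N $ k))"

definition spectral_norm :: "real ^ 'b ^ 'a \<Rightarrow> real" where
  "spectral_norm X = onorm ((*v) X)"

definition mexp :: "real ^ 'n ^ 'n \<Rightarrow> real ^ 'n ^ 'n" where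
  "mexp A = (\<Sum>k. (1 / fact k) *\<^sub>R (((**) A ^^ k) (mat 1)))"

definition eigenvalues :: "real ^ 'n ^ 'n \<Rightarrow> complex set" where
  "eigenvalues A =
     {\<mu>. \<exists>v :: complex ^ 'n. v \<noteq> 0 \<and> (\<chi> i j. complex_of_real (A $ i $ j)) *v v = \<mu> *s v}"

definition stable :: "real ^ 'n ^ 'n \<Rightarrow> bool" where
  "stable A \<longleftrightarrow> (\<forall>\<mu>\<in>eigenvalues A. Re \<mu> < 0)"

definition stability_params :: "real ^ 'n ^ 'n \<Rightarrow> real \<Rightarrow> real \<Rightarrow> bool" where
  "stability_params A \<alpha> \<beta> \<longleftrightarrow>
     \<beta> > 0 \<and> 0 < \<alpha> \<and> \<alpha> \<le> - Max (Re ` eigenvalues A) \<and>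
     (\<forall>t\<ge>0. spectral_norm (mexp (t *\<^sub>R A)) \<le> \<beta> * exp (- \<alpha> * t))"

definition block_diag :: "real ^ 'b ^ 'a \<Rightarrow> real ^ 'd ^ 'c \<Rightarrow> real ^ ('b + 'd) ^ ('a + 'c)" where
  "block_diag X Y = (\<chi> i j. case (i, j) of
      (Inl a, Inl b) \<Rightarrow> X $ a $ b
    | (Inr c, Inr d) \<Rightarrow> Y $ c $ d
    | _ \<Rightarrow> 0)"

definition stack :: "real ^ 'b ^ 'a \<Rightarrow> real ^ 'b ^ 'c \<Rightarrow> real ^ 'b ^ ('a + 'c)" where
  "stack X Y = (\<chi> i. case i of Inl a \<Rightarrow> X $ a | Inr c \<Rightarrow> Y $ c)"

definition beside :: "real ^ 'b ^ 'a \<Rightarrow> real ^ 'd ^ 'a \<Rightarrow> real ^ ('b + 'd) ^ 'a" where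
  "beside X Y = (\<chi> i j. case j of Inl b \<Rightarrow> X $ i $ b | Inr d \<Rightarrow> Y $ i $ d)"

section \<open>Matrices with a varying number of columns\<close>

text \<open>
  The kernel \<open>P\<^sub>i\<close> has \<open>m ^ i\<close> columns, so the column dimension cannot be a type depending on \<open>i\<close>.
  Such matrices are plain functions; the columns of \<open>P\<^sub>i\<close> are indexed by the words of length \<open>i\<close>
  over the input index type, and the index \<open>(k, w)\<close> of a column of \<open>I\<^sub>m \<otimes> P\<^sub>i\<close> is
  identified with the word \<open>k # w\<close>. Kronecker products have pairs as row and column indices,
  the left factor giving the outer (block) index.
\<close>

type_synonym ('a, 'b) fmat = "'a \<Rightarrow> 'b \<Rightarrow> real"

definition entries :: "real ^ 'b ^ 'a \<Rightarrow> ('a, 'b) fmat" where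
  "entries X = (\<lambda>i j. X $ i $ j)"

definition fmul :: "('a, 'b::finite) fmat \<Rightarrow> ('b, 'c) fmat \<Rightarrow> ('a, 'c) fmat"  (infixl \<open>\<odot>\<close> 70) where
  "X \<odot> Y = (\<lambda>i k. \<Sum>j\<in>UNIV. X i j * Y j k)"

definition kron :: "('a, 'b) fmat \<Rightarrow> ('c, 'd) fmat \<Rightarrow> ('a \<times> 'c, 'b \<times> 'd) fmat"  (infixl \<open>\<otimes>\<^sub>K\<close> 75) where
  "X \<otimes>\<^sub>K Y = (\<lambda>(i, i') (j, j'). X i j * Y i' j')"

definition frob_norm :: "'b set \<Rightarrow> ('a::finite, 'b) fmat \<Rightarrow> real" where
  "frob_norm cols H = sqrt (\<Sum>i\<in>UNIV. \<Sum>j\<in>cols. (H i j)\<^sup>2)"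

definition words :: "nat \<Rightarrow> 'm list set" where
  "words i = {w. length w = i}"

section \<open>Bilinear quadratic output systems\<close>

text \<open>
  A system of order \<open>CARD('n)\<close> with \<open>CARD('m)\<close> inputs and \<open>CARD('p)\<close> outputs is the tuple
  \<open>(A, B, C, (N\<^sub>k)\<^sub>k, (M\<^sub>j)\<^sub>j)\<close>, so that systems carry the product topology of their matrices;
  symmetry of the \<open>M\<^sub>j\<close> is imposed by \<open>bqo_systems\<close>.
\<close>

type_synonym ('n, 'm, 'p) bqo =
  "(real ^ 'n ^ 'n) \<times> (real ^ 'm ^ 'n) \<times> (real ^ 'n ^ 'p) \<times> (real ^ 'n ^ 'n ^ 'm) \<times> (real ^ 'n ^ 'n ^ 'p)"

definition bqo_systems :: "('n::finite, 'm::finite, 'p::finite) bqo set" where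
  "bqo_systems = {(A, B, C, N, M). \<forall>j. transpose (M $ j) = M $ j}"

text \<open>\<open>[vec(M\<^sub>1) \<dots> vec(M\<^sub>p)]\<^sup>T\<close>, where \<open>vec\<close> stacks columns: entry \<open>(c, r)\<close> of
  \<open>vec(M)\<close> is \<open>M\<^sub>r\<^sub>c\<close>.\<close>

definition vecs_transposed :: "real ^ 'n ^ 'n ^ 'p \<Rightarrow> real ^ ('n \<times> 'n) ^ 'p" where
  "vecs_transposed M = (\<chi> j cr. M $ j $ snd cr $ fst cr)"

text \<open>\<open>Pbar A B N i t\<close> is the kernel \<open>P\<^sub>i(t\<^sub>1, \<dots>, t\<^sub>i)\<close> for \<open>i \<ge> 1\<close>; the value at
  \<open>i = 0\<close> is a dummy.\<close>

fun Pbar :: "real ^ 'n ^ 'n \<Rightarrow> real ^ 'm ^ 'n \<Rightarrow> real ^ 'n ^ 'n ^ 'm \<Rightarrow> nat \<Rightarrow> (nat \<Rightarrow> real)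
    \<Rightarrow> ('n, 'm list) fmat" where
  "Pbar A B N 0 t = (\<lambda>a w. 0)"
| "Pbar A B N (Suc 0) t = (\<lambda>a w. (entries (mexp (t 1 *\<^sub>R A)) \<odot> entries B) a (hd w))"
| "Pbar A B N (Suc (Suc i)) t =
     (\<lambda>a w. (entries (mexp (t (Suc (Suc i)) *\<^sub>R A)) \<odot> entries (hcat N)
              \<odot> (entries (mat 1 :: real ^ 'm ^ 'm) \<otimes>\<^sub>K Pbar A B N (Suc i) t)) a (hd w, tl w))"

definition h_C :: "('n::finite, 'm::finite, 'p::finite) bqo \<Rightarrow> nat \<Rightarrow> (nat \<Rightarrow> real)
    \<Rightarrow> ('p, 'm list) fmat" where
  "h_C S i t = (case S of (A, B, C, N, M) \<Rightarrow> entries C \<odot> Pbar A B N i t)"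

definition h_M :: "('n::finite, 'm::finite, 'p::finite) bqo \<Rightarrow> nat \<Rightarrow> nat \<Rightarrow> (nat \<Rightarrow> real) \<Rightarrow> (nat \<Rightarrow> real)
    \<Rightarrow> ('p, 'm list \<times> 'm list) fmat" where
  "h_M S i j t s = (case S of (A, B, C, N, M) \<Rightarrow>
     entries (vecs_transposed M) \<odot> (Pbar A B N i t \<otimes>\<^sub>K Pbar A B N j s))"

definition time_measure :: "nat \<Rightarrow> (nat \<Rightarrow> real) measure" where
  "time_measure i = (\<Pi>\<^sub>M k\<in>{1..i}. restrict_space lborel {0..})"

text \<open>The squared \<open>H\<^sub>2\<close> norm as an extended nonnegative number: \<open>\<infinity>\<close> if a series or
  an integral diverges, so that the error of a divergent system never undercuts another. The summation indices are shifted by one, since the series start at \<open>1\<close>.\<close>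

definition H2_norm_sq :: "('n::finite, 'm::finite, 'p::finite) bqo \<Rightarrow> ennreal" where
  "H2_norm_sq S =
     (\<Sum>i. \<integral>\<^sup>+t. ennreal ((frob_norm (words (Suc i)) (h_C S (Suc i) t))\<^sup>2) \<partial>time_measure (Suc i))
   + (\<Sum>i. \<Sum>j. \<integral>\<^sup>+t. \<integral>\<^sup>+s.
         ennreal ((frob_norm (words (Suc i) \<times> words (Suc j)) (h_M S (Suc i) (Suc j) t s))\<^sup>2)
         \<partial>time_measure (Suc j) \<partial>time_measure (Suc i))"

definition error_system :: "('n::finite, 'm::finite, 'p::finite) bqo \<Rightarrow> ('r::finite, 'm, 'p) bqo
    \<Rightarrow> ('n + 'r, 'm, 'p) bqo" where
  "error_system S S' = (case (S, S') of ((A, B, C, N, M), (A', B', C', N', M')) \<Rightarrow>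
     (block_diag A A', stack B B', beside C (- C'),
      \<chi> k. block_diag (N $ k) (N' $ k), \<chi> j. block_diag (M $ j) (- (M' $ j))))"

definition locally_H2_optimal :: "('n::finite, 'm::finite, 'p::finite) bqo \<Rightarrow> ('r::finite, 'm, 'p) bqo
    \<Rightarrow> bool" where
  "locally_H2_optimal S S' \<longleftrightarrow>
     S' \<in> bqo_systems \<and>
     (\<forall>\<^sub>F T in at S' within bqo_systems.
        H2_norm_sq (error_system S S') \<le> H2_norm_sq (error_system S T))"

end

theory Submission
  imports Defs
begin

text \<open>
  The squared H2 norm of a system depends on its input side through one matrix only, the Gramian
  \<open>P\<close> that solves \<open>A P + P A\<^sup>T + \<Sum> N\<^sub>k P N\<^sub>k\<^sup>T + B B\<^sup>T = 0\<close>: it equals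
  \<open>tr (C P C\<^sup>T) + \<Sum> tr (M\<^sub>j P M\<^sub>j P)\<close> (\<open>H2_norm_sq_eq_gramian_cost\<close>). The Gramian of the error system
  has the off-diagonal block \<open>X\<close> and the lower block \<open>Ph\<close>, and it depends differentiably on the
  reduced matrices; a local minimum of the error is therefore a critical point along every line
  through the reduced system. The derivative of the Gramian drops out when it is paired with the
  solution of the dual equation, whose blocks are \<open>-\<Phi>\<close> and \<open>\<Psi>\<close>. What remains is an explicit linear
  functional of the direction (\<open>H2_first_order_condition\<close>). In the direction that consists of the
  five matrices to be shown zero, that functional is the sum of their squared Frobenius norms.

  The analysis rests on one notion, a certificate for \<open>(A, N)\<close>: a positive semidefinite \<open>Q\<close> for which
  \<open>A Q + Q A\<^sup>T + \<Sum> N\<^sub>k Q N\<^sub>k\<^sup>T\<close> is negative definite. It yields a comparison principle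
  (\<open>lyap_comparison\<close>), and with it the unique solvability of all the matrix equations involved. It
  makes the energies of the kernels converge geometrically to the quadratic form of \<open>P\<close>
  (\<open>kernel_energy_sums\<close>). It passes to the error system and survives small perturbations, so that
  the H2 norm stays finite and is given by the formula above on a whole neighbourhood. The stability
  parameters together with the bound on \<open>[N\<^sub>1 \<dots> N\<^sub>m]\<close> provide such a certificate, the integral of
  \<open>e\<^sup>A\<^sup>t (e\<^sup>A\<^sup>t)\<^sup>T\<close> over a long time interval (\<open>lyap_certificate_exists\<close>).
\<close>

section \<open>Matrices as quadratic forms\<close>

text \<open>
  The transposed action \<open>A\<^sup>T x\<close> is written \<open>x v* A\<close>, which is the normal form that simplification
  gives to \<open>transpose A *v x\<close>.
\<close>

definition qform :: "real ^ 'n ^ 'n \<Rightarrow> real ^ 'n \<Rightarrow> real" where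
  "qform P x = x \<bullet> (P *v x)"

lemma qform_add: "qform (P + Q) x = qform P x + qform Q x"
  by (simp add: qform_def algebra_simps inner_add_right)

lemma qform_diff: "qform (P - Q) x = qform P x - qform Q x"
  by (simp add: qform_def algebra_simps inner_diff_right)

lemma qform_scaleR: "qform (r *\<^sub>R P) x = r * qform P x"
  by (simp add: qform_def scaleR_matrix_vector_assoc[symmetric])

lemma qform_sum: "qform (\<Sum>k\<in>K. P k) x = (\<Sum>k\<in>K. qform (P k) x)"
  by (induction K rule: infinite_finite_induct) (simp_all add: qform_add, simp_all add: qform_def)

lemma qform_zero [simp]: "qform 0 x = 0"
  by (simp add: qform_def)

lemma qform_mat_1 [simp]: "qform (mat 1) x = x \<bullet> x"
  by (simp add: qform_def)

lemma qform_scaleR_vector: "qform P (r *\<^sub>R x) = r\<^sup>2 * qform P x"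
  by (simp add: qform_def matrix_vector_mult_scaleR power2_eq_square)

lemma inner_matrix_vector: "x \<bullet> (P *v y) = (x v* P) \<bullet> (y :: real ^ _)"
  by (simp add: dot_lmul_matrix)

lemma inner_symmetric_matrix:
  assumes "transpose P = (P :: real ^ 'n ^ 'n)"
  shows "x \<bullet> (P *v y) = y \<bullet> (P *v x)"
  by (metis assms dot_lmul_matrix inner_commute transpose_matrix_vector)

lemma vector_matrix_mul_assoc: "x v* (P ** Q) = (x v* P) v* (Q :: real ^ _ ^ _)"
  by (metis matrix_transpose_mul matrix_vector_mul_assoc transpose_matrix_vector)

lemma qform_congruence: "qform (D ** P ** transpose D) x = qform P (x v* D)"
  by (simp add: qform_def matrix_vector_mul_assoc[symmetric] dot_lmul_matrix[symmetric])

lemma qform_gram: "qform (D ** transpose D) x = (x v* D) \<bullet> (x v* D)"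
  using qform_congruence[of D "mat 1" x] by simp

lemma qform_plus:
  assumes "transpose P = P"
  shows "qform P (x + y) = qform P x + 2 * (x \<bullet> (P *v y)) + qform P y"
  using inner_symmetric_matrix[OF assms, of x y]
  by (simp add: qform_def matrix_vector_right_distrib inner_add_left inner_add_right)

lemma bounded_bilinear_matrix_mult: "bounded_bilinear ((**) :: real ^ 'b ^ 'a \<Rightarrow> real ^ 'c ^ 'b \<Rightarrow> _)"
  unfolding bilinear_conv_bounded_bilinear[symmetric] bilinear_def
  by (intro conjI allI linearI)
     (simp_all add: vec_eq_iff matrix_matrix_mult_def sum_distrib_left sum.distrib ring_distribs ac_simps)

lemma bounded_bilinear_matrix_vector_mult:
  "bounded_bilinear ((*v) :: real ^ 'b ^ 'a \<Rightarrow> real ^ 'b \<Rightarrow> _)"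
  unfolding bilinear_conv_bounded_bilinear[symmetric] bilinear_def
  by (intro conjI allI linearI)
     (simp_all add: vec_eq_iff matrix_vector_mult_def sum_distrib_left sum.distrib ring_distribs ac_simps)

lemma bounded_bilinear_vector_matrix_mult:
  "bounded_bilinear ((v*) :: real ^ 'a \<Rightarrow> real ^ 'b ^ 'a \<Rightarrow> _)"
  unfolding bilinear_conv_bounded_bilinear[symmetric] bilinear_def
  by (intro conjI allI linearI)
     (simp_all add: vec_eq_iff vector_matrix_mult_def sum_distrib_left sum.distrib ring_distribs ac_simps)

lemma bounded_linear_transpose: "bounded_linear (transpose :: real ^ 'b ^ 'a \<Rightarrow> _)"
  unfolding linear_conv_bounded_linear[symmetric]
  by (intro linearI) (simp_all add: vec_eq_iff transpose_def)

interpretation matrix_mult: bounded_bilinear "(**) :: real ^ 'b ^ 'a \<Rightarrow> real ^ 'c ^ 'b \<Rightarrow> _"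
  by (rule bounded_bilinear_matrix_mult)

interpretation matrix_vector: bounded_bilinear "(*v) :: real ^ 'b ^ 'a \<Rightarrow> real ^ 'b \<Rightarrow> _"
  by (rule bounded_bilinear_matrix_vector_mult)

interpretation vector_matrix: bounded_bilinear "(v*) :: real ^ 'a \<Rightarrow> real ^ 'b ^ 'a \<Rightarrow> _"
  by (rule bounded_bilinear_vector_matrix_mult)

lemma transpose_linear_simps:
  "transpose (Y + Z) = transpose Y + transpose Z"
  "transpose (Y - Z) = transpose Y - transpose Z"
  "transpose (- Y) = - transpose Y"
  "transpose 0 = (0 :: real ^ 'b ^ 'a)"
  "transpose (\<Sum>k\<in>K. f k) = (\<Sum>k\<in>K. transpose (f k))"
  for Y Z :: "real ^ 'a ^ 'b" and f :: "'k \<Rightarrow> real ^ 'a ^ 'b"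
  by (simp_all add: vec_eq_iff transpose_def)

text \<open>The inner product is \<open>tr (Y\<^sup>T Z)\<close>, so multiplication by \<open>D\<close> has the adjoint multiplication by \<open>D\<^sup>T\<close>.\<close>

lemma inner_matrix_mult_left: "Y \<bullet> (D ** Z) = (transpose D ** Y) \<bullet> (Z :: real ^ 'c ^ 'b)"
proof -
  have "Y \<bullet> (D ** Z) = (\<Sum>i\<in>UNIV. \<Sum>j\<in>UNIV. \<Sum>k\<in>UNIV. Y $ i $ j * (D $ i $ k * Z $ k $ j))"
    by (simp add: inner_vec_def matrix_matrix_mult_def sum_distrib_left)
  also have "\<dots> = (\<Sum>i\<in>UNIV. \<Sum>k\<in>UNIV. \<Sum>j\<in>UNIV. Y $ i $ j * (D $ i $ k * Z $ k $ j))"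
    by (intro sum.cong refl sum.swap)
  also have "\<dots> = (\<Sum>k\<in>UNIV. \<Sum>i\<in>UNIV. \<Sum>j\<in>UNIV. Y $ i $ j * (D $ i $ k * Z $ k $ j))"
    by (rule sum.swap)
  also have "\<dots> = (\<Sum>k\<in>UNIV. \<Sum>j\<in>UNIV. \<Sum>i\<in>UNIV. Y $ i $ j * (D $ i $ k * Z $ k $ j))"
    by (intro sum.cong refl sum.swap)
  also have "\<dots> = (transpose D ** Y) \<bullet> Z"
    by (simp add: inner_vec_def matrix_matrix_mult_def sum_distrib_left transpose_def ac_simps)
  finally show ?thesis .
qed

lemma inner_transpose: "transpose Y \<bullet> transpose Z = Y \<bullet> (Z :: real ^ 'b ^ 'a)"
  unfolding inner_vec_def transpose_def by simp (rule sum.swap)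

lemma inner_transpose_left: "transpose Y \<bullet> Z = Y \<bullet> transpose (Z :: real ^ 'b ^ 'a)"
  using inner_transpose[of Y "transpose Z"] by simp

lemma inner_matrix_mult_right: "Y \<bullet> (Z ** D) = (Y ** transpose D) \<bullet> (Z :: real ^ 'b ^ 'a)"
proof -
  have "Y \<bullet> (Z ** D) = transpose Y \<bullet> (transpose D ** transpose Z)"
    by (simp add: inner_transpose matrix_transpose_mul[symmetric])
  also have "\<dots> = transpose (Y ** transpose D) \<bullet> transpose Z"
    by (simp add: inner_matrix_mult_left matrix_transpose_mul)
  finally show ?thesis by (simp add: inner_transpose)
qed

definition psd :: "real ^ 'n ^ 'n \<Rightarrow> bool" where
  "psd P \<longleftrightarrow> transpose P = P \<and> (\<forall>x. 0 \<le> qform P x)"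

lemma psd_transpose: "psd P \<Longrightarrow> transpose P = P"
  and psd_nonneg: "psd P \<Longrightarrow> 0 \<le> qform P x"
  by (simp_all add: psd_def)

lemma nonneg_quadratic_imp_linear_coeff_0:
  fixes a b :: real
  assumes "\<And>t. 0 \<le> t * a + t\<^sup>2 * b"
  shows "a = 0"
proof (rule ccontr)
  assume "a \<noteq> 0"
  define d where "d = \<bar>b\<bar> + 1"
  have d: "d > 0" "b < d" by (auto simp: d_def)
  \<comment> \<open>As \<open>b < d\<close>, the point \<open>- a / d\<close> is close enough to \<open>0\<close> for the linear term to dominate.\<close>
  have "0 \<le> (- a / d) * a + (- a / d)\<^sup>2 * b"
    by (rule assms)
  then have "0 \<le> d\<^sup>2 * ((- a / d) * a + (- a / d)\<^sup>2 * b)"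
    by (intro mult_nonneg_nonneg) auto
  also have "\<dots> = a\<^sup>2 * (b - d)"
    using d(1) by (simp add: power2_eq_square algebra_simps)
  also have "\<dots> < 0"
    using d \<open>a \<noteq> 0\<close> by (intro mult_pos_neg) auto
  finally show False by simp
qed

text \<open>On the line \<open>x + t y\<close> through a zero of the form, the form is a quadratic polynomial in \<open>t\<close> without
  constant term; being nonnegative, it has no linear term either.\<close>

lemma psd_null_vector:
  assumes "psd P" "qform P x = 0"
  shows "P *v x = 0"
proof -
  have "y \<bullet> (P *v x) = 0" for y
  proof -
    have "0 \<le> t * (2 * (x \<bullet> (P *v y))) + t\<^sup>2 * qform P y" for t
    proof -
      have "0 \<le> qform P (x + t *\<^sub>R y)"
        by (rule psd_nonneg[OF assms(1)])
      also have "\<dots> = 2 * (x \<bullet> (P *v (t *\<^sub>R y))) + t\<^sup>2 * qform P y"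
        unfolding qform_plus[OF psd_transpose[OF assms(1)]] assms(2) qform_scaleR_vector by simp
      finally show ?thesis by (simp add: matrix_vector_mult_scaleR)
    qed
    from nonneg_quadratic_imp_linear_coeff_0[OF this] show ?thesis
      using inner_symmetric_matrix[OF psd_transpose[OF assms(1)], of x y] by simp
  qed
  from this[of "P *v x"] show ?thesis by simp
qed

lemma matrix_eq_0_if_qform_eq_0:
  assumes "transpose P = P" "\<And>x. qform P x = 0"
  shows "P = 0"
proof -
  have "psd P" using assms by (simp add: psd_def)
  then have "P *v x = 0" for x
    using psd_null_vector assms(2) by blast
  then show ?thesis
    by (simp add: matrix_eq)
qed

text \<open>One step of a Cholesky factorization: \<open>(g \<bullet> x)\<^sup>2\<close> is the part of the form that is visible in the
  direction \<open>v\<close>. The remainder is insensitive to shifts along \<open>v\<close>, and at the shift of \<open>x\<close> that is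
  orthogonal to \<open>g\<close> it coincides with \<open>P\<close>; hence it is nonnegative.\<close>

lemma psd_remove_direction:
  fixes P :: "real ^ 'n ^ 'n"
  assumes P: "psd P" and v: "qform P v \<noteq> 0"
  defines "g \<equiv> (1 / sqrt (qform P v)) *\<^sub>R (P *v v)"
  defines "P' \<equiv> P - (\<chi> a b. g $ a * g $ b)"
  shows "psd P'" "qform P' x = qform P x - (g \<bullet> x)\<^sup>2" "P' *v v = 0"
    "P *v w = 0 \<Longrightarrow> P' *v w = 0"
proof -
  have pos: "qform P v > 0"
    using psd_nonneg[OF P, of v] v by simp
  have "(\<chi> a b. g $ a * g $ b) *v x = (g \<bullet> x) *\<^sub>R g" for x
    by (simp add: vec_eq_iff matrix_vector_mult_def inner_vec_def sum_distrib_left ac_simps)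
  then have mv: "P' *v x = P *v x - (g \<bullet> x) *\<^sub>R g" for x
    by (simp add: P'_def matrix_vector_mult_diff_rdistrib)
  show q: "qform P' x = qform P x - (g \<bullet> x)\<^sup>2" for x
    by (simp add: qform_def mv inner_diff_right power2_eq_square inner_commute)
  have sym: "transpose P' = P'"
    using psd_transpose[OF P] by (simp add: P'_def transpose_def vec_eq_iff mult.commute)
  have gx: "g \<bullet> x = (x \<bullet> (P *v v)) / sqrt (qform P v)" for x
    by (simp add: g_def inner_commute)
  show v0: "P' *v v = 0"
    using pos by (simp add: mv gx qform_def[symmetric] real_div_sqrt) (simp add: g_def)
  show "P' *v w = 0" if "P *v w = 0"
    using that inner_symmetric_matrix[OF psd_transpose[OF P], of w v] by (simp add: mv gx)
  have "0 \<le> qform P' x" for x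
  proof -
    define r where "r = - (g \<bullet> x) / (g \<bullet> v)"
    have gv: "g \<bullet> v \<noteq> 0" using pos by (simp add: gx qform_def[symmetric])
    have "qform P' (x + r *\<^sub>R v) = qform P' x"
      by (simp add: qform_plus[OF sym] matrix_vector_mult_scaleR v0 qform_scaleR_vector)
         (simp add: qform_def v0)
    moreover have "g \<bullet> (x + r *\<^sub>R v) = 0"
      using gv by (simp add: r_def inner_add_right inner_diff_right)
    ultimately show ?thesis
      using q[of "x + r *\<^sub>R v"] psd_nonneg[OF P, of "x + r *\<^sub>R v"] by simp
  qed
  with sym show "psd P'" by (simp add: psd_def)
qed

text \<open>Every removed direction joins the kernel, so at most \<open>CARD('n)\<close> steps exhaust the form.\<close>

lemma psd_gram_decomposition:
  fixes P :: "real ^ 'n ^ 'n"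
  assumes "psd P"
  shows "\<exists>gs :: (real ^ 'n) list. \<forall>x. qform P x = (\<Sum>g\<leftarrow>gs. (g \<bullet> x)\<^sup>2)"
  using assms
proof (induction "CARD('n) - dim {x. P *v x = 0}" arbitrary: P rule: less_induct)
  case less
  show ?case
  proof (cases "\<forall>v. qform P v = 0")
    case True
    then show ?thesis by (intro exI[of _ "[]"]) simp
  next
    case False
    then obtain v where v: "qform P v \<noteq> 0" by blast
    define g where "g = (1 / sqrt (qform P v)) *\<^sub>R (P *v v)"
    define P' where "P' = P - (\<chi> a b. g $ a * g $ b)"
    note * = psd_remove_direction[OF less.prems v, folded g_def, folded P'_def]
    have sub: "subspace {x. Q *v x = 0}" for Q :: "real ^ 'n ^ 'n"
      by (auto simp: subspace_def matrix_vector_right_distrib matrix_vector_mult_scaleR)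
    have "P *v v \<noteq> 0" using v by (auto simp: qform_def)
    then have "{x. P *v x = 0} \<subset> {x. P' *v x = 0}"
      using *(3,4) by auto
    then have "dim {x. P *v x = 0} < dim {x. P' *v x = 0}"
      using dim_psubset[of "{x. P *v x = 0}" "{x. P' *v x = 0}"]
      by (simp add: span_eq_iff[THEN iffD2, OF sub])
    moreover have "dim {x. P' *v x = 0} \<le> CARD('n)"
      using dim_subset_UNIV[of "{x. P' *v x = 0}"] by simp
    ultimately have "CARD('n) - dim {x. P' *v x = 0} < CARD('n) - dim {x. P *v x = 0}"
      by simp
    from less.hyps[OF this *(1)] obtain gs where "\<forall>x. qform P' x = (\<Sum>g\<leftarrow>gs. (g \<bullet> x)\<^sup>2)"
      by blast
    moreover have "qform P x = (g \<bullet> x)\<^sup>2 + qform P' x" for x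
      using *(2)[of x] by simp
    ultimately show ?thesis
      by (intro exI[of _ "g # gs"]) simp
  qed
qed

section \<open>Two-by-two block matrices\<close>

definition blk :: "real ^ 'b ^ 'a \<Rightarrow> real ^ 'd ^ 'a \<Rightarrow> real ^ 'b ^ 'c \<Rightarrow> real ^ 'd ^ 'c
    \<Rightarrow> real ^ ('b + 'd) ^ ('a + 'c)" where
  "blk P X Y Q = (\<chi> i j. case i of
      Inl a \<Rightarrow> (case j of Inl b \<Rightarrow> P $ a $ b | Inr d \<Rightarrow> X $ a $ d)
    | Inr c \<Rightarrow> (case j of Inl b \<Rightarrow> Y $ c $ b | Inr d \<Rightarrow> Q $ c $ d))"

lemma blk_nth [simp]:
  "blk P X Y Q $ Inl a $ Inl b = P $ a $ b" "blk P X Y Q $ Inl a $ Inr d = X $ a $ d"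
  "blk P X Y Q $ Inr c $ Inl b = Y $ c $ b" "blk P X Y Q $ Inr c $ Inr d = Q $ c $ d"
  by (simp_all add: blk_def)

lemma sum_UNIV_Plus:
  "(\<Sum>k\<in>UNIV. f (k :: 'a::finite + 'b::finite)) = (\<Sum>a\<in>UNIV. f (Inl a)) + (\<Sum>b\<in>UNIV. f (Inr b))"
  using sum.Plus[of "UNIV :: 'a set" "UNIV :: 'b set" f] by (simp add: comp_def UNIV_Plus_UNIV)

lemma block_diag_eq_blk: "block_diag X Y = blk X 0 0 Y"
  by (simp add: block_diag_def vec_eq_iff split_sum_all)

lemma blk_eq_0_iff: "blk P X Y Q = 0 \<longleftrightarrow> P = 0 \<and> X = 0 \<and> Y = 0 \<and> Q = 0"
  by (simp add: vec_eq_iff split_sum_all all_conj_distrib)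

lemma blk_mult:
  "blk P X Y Q ** blk P' X' Y' Q'
    = blk (P ** P' + X ** Y') (P ** X' + X ** Q') (Y ** P' + Q ** Y') (Y ** X' + Q ** Q')"
  by (simp add: vec_eq_iff split_sum_all matrix_matrix_mult_def sum_UNIV_Plus)

lemma blk_transpose:
  "transpose (blk P X Y Q) = blk (transpose P) (transpose Y) (transpose X) (transpose Q)"
  by (simp add: vec_eq_iff split_sum_all transpose_def)

lemma blk_linear:
  "blk P X Y Q + blk P' X' Y' Q' = blk (P + P') (X + X') (Y + Y') (Q + Q')"
  "- blk P X Y Q = blk (- P) (- X) (- Y) (- Q)"
  "r *\<^sub>R blk P X Y Q = blk (r *\<^sub>R P) (r *\<^sub>R X) (r *\<^sub>R Y) (r *\<^sub>R Q)"
  "(\<Sum>k\<in>K. blk (fP k) (fX k) (fY k) (fQ k)) = blk (sum fP K) (sum fX K) (sum fY K) (sum fQ K)"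
  by (simp_all add: vec_eq_iff split_sum_all)

lemma blk_inner: "blk P X Y Q \<bullet> blk P' X' Y' Q' = P \<bullet> P' + X \<bullet> X' + Y \<bullet> Y' + Q \<bullet> Q'"
  by (simp add: inner_vec_def sum_UNIV_Plus sum.distrib)

lemma stack_mult_transpose:
  "stack X Y ** transpose (stack X' Y')
    = blk (X ** transpose X') (X ** transpose Y') (Y ** transpose X') (Y ** transpose Y')"
  by (simp add: vec_eq_iff split_sum_all matrix_matrix_mult_def stack_def transpose_def)

lemma transpose_mult_beside:
  "transpose (beside X Y) ** beside X' Y'
    = blk (transpose X ** X') (transpose X ** Y') (transpose Y ** X') (transpose Y ** Y')"
  by (simp add: vec_eq_iff split_sum_all matrix_matrix_mult_def beside_def transpose_def)

lemma beside_mult_blk: "beside X Y ** blk P Z W Q = beside (X ** P + Y ** W) (X ** Z + Y ** Q)"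
  by (simp add: vec_eq_iff split_sum_all matrix_matrix_mult_def beside_def sum_UNIV_Plus)

lemma beside_inner: "beside X Y \<bullet> beside X' Y' = X \<bullet> X' + Y \<bullet> Y'"
  by (simp add: inner_vec_def beside_def sum_UNIV_Plus sum.distrib)

lemma qform_blk_diag:
  "qform (blk P 0 0 Q) x = qform P (\<chi> a. x $ Inl a) + qform Q (\<chi> c. x $ Inr c)"
  by (simp add: qform_def inner_vec_def matrix_vector_mult_def sum_UNIV_Plus)

lemma inner_blk_vector: "x \<bullet> x = (\<chi> a. x $ Inl a) \<bullet> (\<chi> a. x $ Inl a) + (\<chi> c. x $ Inr c) \<bullet> (\<chi> c. x $ Inr c)"
  for x :: "real ^ ('a::finite + 'c::finite)"
  by (simp add: inner_vec_def sum_UNIV_Plus)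

section \<open>Bilinear Sylvester and Lyapunov operators\<close>

text \<open>The two-sided operator covers all four equations of the problem: equal arguments give the Lyapunov
  equation of a Gramian, the mixed case the equation for \<open>X\<close>, and transposed arguments the dual
  equations for \<open>\<Psi>\<close> and \<open>\<Phi>\<close>.\<close>

definition sylvester :: "real ^ 'a ^ 'a \<Rightarrow> real ^ 'b ^ 'b \<Rightarrow> real ^ 'a ^ 'a ^ 'm \<Rightarrow> real ^ 'b ^ 'b ^ 'm
    \<Rightarrow> real ^ 'b ^ 'a \<Rightarrow> real ^ 'b ^ 'a" where
  "sylvester A A' N N' X =
     A ** X + X ** transpose A' + (\<Sum>k\<in>UNIV. N $ k ** X ** transpose (N' $ k))"

abbreviation lyap :: "real ^ 'n ^ 'n \<Rightarrow> real ^ 'n ^ 'n ^ 'm \<Rightarrow> real ^ 'n ^ 'n \<Rightarrow> real ^ 'n ^ 'n" where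
  "lyap A N \<equiv> sylvester A A N N"

lemma linear_sylvester: "linear (sylvester A A' N N')"
  unfolding sylvester_def
  by (rule linearI)
     (simp_all add: matrix_mult.add_left matrix_mult.add_right matrix_mult.scaleR_left
       matrix_mult.scaleR_right sum.distrib scaleR_right.sum scaleR_add_right)

lemma transpose_sylvester:
  "transpose (sylvester A A' N N' X) = sylvester A' A N' N (transpose X)"
  by (simp add: sylvester_def transpose_linear_simps matrix_transpose_mul matrix_mul_assoc add_ac)

lemma sylvester_adjoint:
  "Y \<bullet> sylvester A A' N N' X
    = sylvester (transpose A) (transpose A') (transposes N) (transposes N') Y \<bullet> X"
proof -
  have "Y \<bullet> (N $ k ** X ** transpose (N' $ k))
      = (transpose (N $ k) ** Y ** transpose (transpose (N' $ k))) \<bullet> X" for k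
    unfolding inner_matrix_mult_right[of Y "N $ k ** X" "transpose (N' $ k)"]
      inner_matrix_mult_left[of _ "N $ k" X] by (simp add: matrix_mul_assoc)
  moreover have "Y \<bullet> (X ** transpose A') = (Y ** transpose (transpose A')) \<bullet> X"
    by (rule inner_matrix_mult_right)
  moreover have "Y \<bullet> (A ** X) = (transpose A ** Y) \<bullet> X"
    by (rule inner_matrix_mult_left)
  ultimately show ?thesis
    unfolding sylvester_def transposes_def
    by (simp only: inner_add_left inner_add_right inner_sum_left inner_sum_right vec_lambda_beta)
qed

lemma qform_lyap:
  assumes "transpose Z = Z"
  shows "qform (lyap A N Z) x = 2 * ((x v* A) \<bullet> (Z *v x)) + (\<Sum>k\<in>UNIV. qform Z (x v* N $ k))"
proof -
  have "qform (A ** Z) x = (x v* A) \<bullet> (Z *v x)"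
    by (simp add: qform_def matrix_vector_mul_assoc[symmetric] inner_matrix_vector[of x A])
  moreover have "qform (Z ** transpose A) x = (x v* A) \<bullet> (Z *v x)"
    using inner_symmetric_matrix[OF assms, of x "x v* A"]
    by (simp add: qform_def matrix_vector_mul_assoc[symmetric])
  ultimately show ?thesis
    by (simp add: sylvester_def qform_add qform_sum qform_congruence)
qed

text \<open>A strict supersolution of the homogeneous Lyapunov equation. Stability enters in this form
  because, for fixed \<open>Q\<close>, the condition is polynomial in \<open>(A, N)\<close> and evidently open.\<close>

definition lyap_certificate :: "real ^ 'n ^ 'n \<Rightarrow> real ^ 'n ^ 'n ^ 'm \<Rightarrow> real ^ 'n ^ 'n \<Rightarrow> bool" where
  "lyap_certificate A N Q \<longleftrightarrow>
     psd Q \<and> (\<exists>c>0. \<forall>x. qform (lyap A N Q) x \<le> - c * (x \<bullet> x))"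

lemma lyap_certificate_neg:
  assumes "lyap_certificate A N Q" "x \<noteq> 0"
  shows "qform (lyap A N Q) x < 0"
proof -
  obtain c where "c > 0" "qform (lyap A N Q) x \<le> - c * (x \<bullet> x)"
    using assms(1) by (auto simp: lyap_certificate_def)
  moreover have "c * (x \<bullet> x) > 0" using \<open>c > 0\<close> assms(2) by simp
  ultimately show ?thesis by linarith
qed

text \<open>At a null vector of a positive semidefinite \<open>Z\<close> the drift terms of \<open>lyap A N Z\<close> vanish and
  only squares remain.\<close>

lemma qform_lyap_null_vector:
  assumes "psd Z" "qform Z x = 0"
  shows "0 \<le> qform (lyap A N Z) x"
  using psd_null_vector[OF assms] psd_nonneg[OF assms(1)]
  by (simp add: qform_lyap psd_transpose[OF assms(1)] sum_nonneg)

lemma lyap_certificate_pos: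
  assumes "lyap_certificate A N Q" "x \<noteq> 0"
  shows "0 < qform Q x"
proof -
  have Q: "psd Q" using assms(1) by (simp add: lyap_certificate_def)
  have "qform Q x \<noteq> 0"
    using qform_lyap_null_vector[OF Q, of x A N] lyap_certificate_neg[OF assms] by auto
  with psd_nonneg[OF Q, of x] show ?thesis by simp
qed

lemma continuous_on_qform: "continuous_on S (qform Z)"
  unfolding qform_def by (intro continuous_intros matrix_vector.continuous_on)

text \<open>A maximum principle. Let \<open>l\<close> be the minimum of the ratio of the forms of \<open>Z\<close> and \<open>Q\<close>, attained at
  \<open>v\<close>. Then \<open>Z - l Q\<close> is positive semidefinite with null vector \<open>v\<close>, so its image under the operator is
  nonnegative at \<open>v\<close>; for \<open>l < 0\<close> the strict inequality for \<open>Q\<close> would make it negative.\<close>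

lemma lyap_comparison:
  fixes A :: "real ^ 'n ^ 'n"
  assumes cert: "lyap_certificate A N Q" and sym: "transpose Z = Z"
    and le: "\<And>x. qform (lyap A N Z) x \<le> 0"
  shows "psd Z"
proof -
  have Q: "psd Q" using cert by (simp add: lyap_certificate_def)
  have "\<exists>v\<in>sphere (0 :: real ^ 'n) 1. \<forall>u\<in>sphere 0 1. qform Z v / qform Q v \<le> qform Z u / qform Q u"
  proof (rule continuous_attains_inf)
    show "continuous_on (sphere 0 1) (\<lambda>v. qform Z v / qform Q v)"
      using lyap_certificate_pos[OF cert]
      by (intro continuous_on_divide continuous_on_qform) (metis less_irrefl norm_zero mem_sphere_0 zero_neq_one)
  qed auto
  then obtain v where v: "norm v = 1"
    and min: "\<And>u. norm u = 1 \<Longrightarrow> qform Z v / qform Q v \<le> qform Z u / qform Q u"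
    by auto
  define l where "l = qform Z v / qform Q v"
  have v0: "v \<noteq> 0" using v by auto
  have "qform Q v \<noteq> 0" using lyap_certificate_pos[OF cert v0] by simp
  then have lv: "qform Z v = l * qform Q v"
    by (simp add: l_def)
  have lower: "l * qform Q x \<le> qform Z x" for x
  proof (cases "x = 0")
    case True
    then show ?thesis by (simp add: qform_def)
  next
    case False
    define u where "u = (1 / norm x) *\<^sub>R x"
    have u: "norm u = 1" "x = norm x *\<^sub>R u" using False by (simp_all add: u_def)
    have "0 < qform Q u" using u(1) by (intro lyap_certificate_pos[OF cert]) auto
    then have "l * qform Q u \<le> qform Z u"
      using min[OF u(1)] by (simp add: l_def[symmetric] field_simps)
    then have "(norm x)\<^sup>2 * (l * qform Q u) \<le> (norm x)\<^sup>2 * qform Z u"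
      by (intro mult_left_mono) auto
    then show ?thesis
      by (subst (1 2) u(2)) (simp add: qform_scaleR_vector mult.left_commute)
  qed
  have "0 \<le> l"
  proof (rule ccontr)
    assume neg: "\<not> 0 \<le> l"
    define Z' where "Z' = Z - l *\<^sub>R Q"
    have "psd Z'"
      using lower sym psd_transpose[OF Q]
      by (simp add: psd_def Z'_def qform_diff qform_scaleR transpose_linear_simps transpose_scalar)
    moreover have "qform Z' v = 0" by (simp add: Z'_def qform_diff qform_scaleR lv)
    ultimately have "0 \<le> qform (lyap A N Z') v" by (rule qform_lyap_null_vector)
    also have "\<dots> = qform (lyap A N Z) v - l * qform (lyap A N Q) v"
      by (simp add: Z'_def linear_diff[OF linear_sylvester] linear_scale[OF linear_sylvester]
          qform_diff qform_scaleR)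
    also have "\<dots> < 0"
      using le[of v] mult_neg_neg[of l, OF _ lyap_certificate_neg[OF cert v0]] neg by simp
    finally show False by simp
  qed
  then have "0 \<le> qform Z x" for x
    using lower[of x] psd_nonneg[OF Q, of x] by (meson mult_nonneg_nonneg order_trans)
  with sym show ?thesis by (simp add: psd_def)
qed

lemma sylvester_blk:
  "lyap (blk A 0 0 A') (\<chi> k. blk (N $ k) 0 0 (N' $ k)) (blk P X Y Q)
    = blk (lyap A N P) (sylvester A A' N N' X) (sylvester A' A N' N Y) (lyap A' N' Q)"
  by (simp add: sylvester_def blk_mult blk_transpose blk_linear transpose_linear_simps)

lemma lyap_certificate_blk:
  assumes "lyap_certificate A N Q" "lyap_certificate A' N' Q'"
  shows "lyap_certificate (blk A 0 0 A') (\<chi> k. blk (N $ k) 0 0 (N' $ k)) (blk Q 0 0 Q')"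
proof -
  obtain c c' where c: "c > 0" "\<And>x. qform (lyap A N Q) x \<le> - c * (x \<bullet> x)"
    and c': "c' > 0" "\<And>x. qform (lyap A' N' Q') x \<le> - c' * (x \<bullet> x)"
    using assms unfolding lyap_certificate_def by blast
  have psd: "psd Q" "psd Q'" using assms by (simp_all add: lyap_certificate_def)
  have "psd (blk Q 0 0 Q')"
    using psd by (simp add: psd_def blk_transpose transpose_linear_simps qform_blk_diag)
  moreover have "qform (lyap (blk A 0 0 A') (\<chi> k. blk (N $ k) 0 0 (N' $ k)) (blk Q 0 0 Q')) x
      \<le> - min c c' * (x \<bullet> x)" for x
  proof -
    define y z where "y = (\<chi> a. x $ Inl a)" and "z = (\<chi> a. x $ Inr a)"
    have "qform (lyap A N Q) y \<le> - min c c' * (y \<bullet> y)"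
      using c(2)[of y] mult_right_mono[of "min c c'" c "y \<bullet> y"] by simp
    moreover have "qform (lyap A' N' Q') z \<le> - min c c' * (z \<bullet> z)"
      using c'(2)[of z] mult_right_mono[of "min c c'" c' "z \<bullet> z"] by simp
    ultimately show ?thesis
      unfolding sylvester_blk linear_0[OF linear_sylvester] qform_blk_diag inner_blk_vector[of x]
      by (simp add: y_def[symmetric] z_def[symmetric] distrib_left)
  qed
  moreover have "min c c' > 0" using c c' by simp
  ultimately show ?thesis unfolding lyap_certificate_def by blast
qed

text \<open>A rectangular \<open>X\<close> is an off-diagonal block of a symmetric solution of the homogeneous equation for the
  block diagonal pair. The comparison principle applies to that solution and to its negative.\<close>

lemma sylvester_eq_0:
  assumes cert: "lyap_certificate A N Q" "lyap_certificate A' N' Q'"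
    and X: "sylvester A A' N N' X = 0"
  shows "X = 0"
proof -
  define Z where "Z = blk 0 X (transpose X) 0"
  define Ae Ne where "Ae = blk A 0 0 A'" and "Ne = (\<chi> k. blk (N $ k) 0 0 (N' $ k))"
  have sym: "transpose Z = Z" by (simp add: Z_def blk_transpose transpose_linear_simps)
  have "sylvester A' A N' N (transpose X) = 0"
    using X by (simp add: transpose_sylvester[symmetric] transpose_linear_simps)
  with X have L: "lyap Ae Ne Z = 0"
    by (simp add: Z_def Ae_def Ne_def sylvester_blk linear_0[OF linear_sylvester] blk_eq_0_iff)
  then have "lyap Ae Ne (- Z) = 0"
    by (simp add: linear_neg[OF linear_sylvester])
  with L have "psd Z" "psd (- Z)"
    using lyap_comparison[OF lyap_certificate_blk[OF cert, folded Ae_def Ne_def]] sym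
    by (simp_all add: transpose_linear_simps)
  then have "0 \<le> qform Z x" "0 \<le> qform (- Z) x" for x by (simp_all add: psd_nonneg)
  then have "qform Z x = 0" for x
    using qform_diff[of 0 Z x] by (metis diff_0 neg_0_le_iff_le order_antisym qform_zero)
  from matrix_eq_0_if_qform_eq_0[OF sym this] show ?thesis
    by (simp add: Z_def blk_eq_0_iff)
qed

lemma sylvester_inject:
  assumes "lyap_certificate A N Q" "lyap_certificate A' N' Q'"
    and "sylvester A A' N N' X = sylvester A A' N N' Y"
  shows "X = Y"
  using sylvester_eq_0[OF assms(1,2), of "X - Y"] assms(3)
  by (simp add: linear_diff[OF linear_sylvester])

lemma lyap_surj:
  assumes "lyap_certificate A N Q"
  obtains P where "lyap A N P = R"
proof -
  have "inj (lyap A N)"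
    using sylvester_inject[OF assms assms] by (auto intro: injI)
  then have "surj (lyap A N)"
    by (rule linear_inj_imp_surj[OF linear_sylvester])
  then show ?thesis using that by (metis surjD)
qed

text \<open>The kernel of the adjoint is orthogonal to the range, which is everything.\<close>

lemma dual_lyap_inject:
  assumes "lyap_certificate A N Q"
    and eq: "lyap (transpose A) (transposes N) Y = lyap (transpose A) (transposes N) Z"
  shows "Y = Z"
proof -
  obtain P where P: "lyap A N P = Y - Z"
    using lyap_surj[OF assms(1)] by blast
  have "(Y - Z) \<bullet> (Y - Z) = lyap (transpose A) (transposes N) (Y - Z) \<bullet> P"
    by (simp only: P[symmetric] sylvester_adjoint)
  also have "\<dots> = 0" by (simp add: linear_diff[OF linear_sylvester] eq)
  finally show ?thesis by simp
qed

lemma dual_lyap_surj: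
  assumes "lyap_certificate A N Q"
  obtains P where "lyap (transpose A) (transposes N) P = R"
proof -
  have "inj (lyap (transpose A) (transposes N))"
    using dual_lyap_inject[OF assms] by (auto intro: injI)
  then have "surj (lyap (transpose A) (transposes N))"
    by (rule linear_inj_imp_surj[OF linear_sylvester])
  then show ?thesis using that by (metis surjD)
qed

lemma lyap_solution_psd:
  assumes cert: "lyap_certificate A N Q" and P: "lyap A N P + B ** transpose B = 0"
  shows "psd P"
proof (rule lyap_comparison[OF cert])
  have P': "lyap A N P = - (B ** transpose B)" using P by (simp add: eq_neg_iff_add_eq_0)
  have "lyap A N (transpose P) = lyap A N P"
    by (simp add: transpose_sylvester[symmetric] P' transpose_linear_simps matrix_transpose_mul)
  then show "transpose P = P" by (rule sylvester_inject[OF cert cert])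
  show "qform (lyap A N P) x \<le> 0" for x
    using qform_diff[of 0 "B ** transpose B" x] by (simp add: P' qform_gram)
qed

lemma qform_bounded: "\<exists>K. \<forall>(D :: real ^ 'n ^ 'n) x. \<bar>qform D x\<bar> \<le> K * norm D * (x \<bullet> x)"
proof -
  obtain K where K: "\<And>(D :: real ^ 'n ^ 'n) (x :: real ^ 'n). norm (D *v x) \<le> norm D * norm x * K"
    using matrix_vector.bounded by blast
  have "\<bar>qform D x\<bar> \<le> K * norm D * (x \<bullet> x)" for D :: "real ^ 'n ^ 'n" and x
  proof -
    have "\<bar>qform D x\<bar> \<le> norm x * norm (D *v x)"
      unfolding qform_def by (rule Cauchy_Schwarz_ineq2)
    also have "\<dots> \<le> norm x * (norm D * norm x * K)"
      by (intro mult_left_mono K) simp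
    also have "\<dots> = K * norm D * (x \<bullet> x)"
      by (simp add: dot_square_norm power2_eq_square)
    finally show ?thesis .
  qed
  then show ?thesis by blast
qed

text \<open>A margin \<open>c\<close> of negative definiteness tolerates any perturbation of the form below \<open>c / 2\<close>. The same
  \<open>Q\<close> serves all nearby parameters.\<close>

lemma lyap_certificate_eventually:
  fixes A :: "real ^ 'n ^ 'n"
  assumes cert: "lyap_certificate A N Q"
    and lim: "((\<lambda>t. lyap (A' t) (N' t) Q) \<longlongrightarrow> lyap A N Q) F"
  shows "\<forall>\<^sub>F t in F. lyap_certificate (A' t) (N' t) Q"
proof -
  obtain c where c: "c > 0" "\<And>x. qform (lyap A N Q) x \<le> - c * (x \<bullet> x)"
    using cert unfolding lyap_certificate_def by blast
  obtain K where K: "\<And>(D :: real ^ 'n ^ 'n) x. \<bar>qform D x\<bar> \<le> K * norm D * (x \<bullet> x)"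
    using qform_bounded by blast
  define e where "e = c / 2 / (\<bar>K\<bar> + 1)"
  have e: "e > 0" "\<bar>K\<bar> * e \<le> c / 2" using c(1) by (simp_all add: e_def field_simps)
  show ?thesis
    using tendstoD[OF lim e(1)]
  proof eventually_elim
    fix t assume "dist (lyap (A' t) (N' t) Q) (lyap A N Q) < e"
    then have D: "norm (lyap (A' t) (N' t) Q - lyap A N Q) \<le> e" by (simp add: dist_norm)
    have "qform (lyap (A' t) (N' t) Q) x \<le> - (c / 2) * (x \<bullet> x)" for x
    proof -
      have "K * norm (lyap (A' t) (N' t) Q - lyap A N Q) \<le> \<bar>K\<bar> * e"
        using D by (intro mult_mono) auto
      also have "\<dots> \<le> c / 2" by (rule e)
      finally have "K * norm (lyap (A' t) (N' t) Q - lyap A N Q) * (x \<bullet> x) \<le> c / 2 * (x \<bullet> x)"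
        by (intro mult_right_mono) auto
      then have "qform (lyap (A' t) (N' t) Q) x - qform (lyap A N Q) x \<le> c / 2 * (x \<bullet> x)"
        using K[of "lyap (A' t) (N' t) Q - lyap A N Q" x] by (simp add: qform_diff)
      with c(2)[of x] show ?thesis by (simp add: algebra_simps)
    qed
    moreover have "psd Q" using cert by (simp add: lyap_certificate_def)
    ultimately show "lyap_certificate (A' t) (N' t) Q"
      unfolding lyap_certificate_def using c(1) by (intro conjI exI[of _ "c / 2"]) auto
  qed
qed

section \<open>The matrix exponential\<close>

abbreviation mpow :: "real ^ 'n ^ 'n \<Rightarrow> nat \<Rightarrow> real ^ 'n ^ 'n" where
  "mpow A k \<equiv> ((**) A ^^ k) (mat 1)"

lemma mpow_commute: "A ** mpow A k = mpow A k ** A"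
proof (induction k)
  case (Suc k)
  have "A ** mpow A (Suc k) = A ** (mpow A k ** A)" using Suc by simp
  then show ?case by (simp add: matrix_mul_assoc)
qed simp

lemma mpow_scaleR: "mpow (t *\<^sub>R A) k = t ^ k *\<^sub>R mpow A k"
  by (induction k) (simp_all add: matrix_mult.scaleR_left matrix_mult.scaleR_right)

lemma summable_mexp:
  fixes A :: "real ^ 'a ^ 'a"
  shows "summable (\<lambda>k. (t ^ k / fact k) *\<^sub>R mpow A k)"
proof -
  obtain K where K: "K > 0" "\<And>(D :: real ^ 'a ^ 'a) (D' :: real ^ 'a ^ 'a). norm (D ** D') \<le> norm D * norm D' * K"
    using matrix_mult.pos_bounded by blast
  have pow: "norm (mpow A k) \<le> norm (mat 1 :: real ^ 'a ^ 'a) * (norm A * K) ^ k" for k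
  proof (induction k)
    case (Suc k)
    have "norm (mpow A (Suc k)) \<le> norm A * norm (mpow A k) * K"
      using K(2)[of A "mpow A k"] by simp
    also have "\<dots> \<le> norm A * (norm (mat 1 :: real ^ 'a ^ 'a) * (norm A * K) ^ k) * K"
      using K(1) by (intro mult_right_mono mult_left_mono Suc) auto
    finally show ?case by (simp add: ac_simps)
  qed simp
  have "norm ((t ^ k / fact k) *\<^sub>R mpow A k)
      \<le> norm (mat 1 :: real ^ 'a ^ 'a) * (inverse (fact k) * (\<bar>t\<bar> * (norm A * K)) ^ k)" for k
  proof -
    have "norm ((t ^ k / fact k) *\<^sub>R mpow A k) = \<bar>t\<bar> ^ k / fact k * norm (mpow A k)"
      by (simp add: power_abs)
    also have "\<dots> \<le> \<bar>t\<bar> ^ k / fact k * (norm (mat 1 :: real ^ 'a ^ 'a) * (norm A * K) ^ k)"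
      by (intro mult_left_mono pow) simp
    finally show ?thesis by (simp add: power_mult_distrib field_simps)
  qed
  then show ?thesis
    by (intro summable_comparison_test'[OF summable_mult[OF summable_exp]]) auto
qed

lemma mexp_eq: "mexp (t *\<^sub>R A) = (\<Sum>k. (t ^ k / fact k) *\<^sub>R mpow A k)"
  by (simp add: mexp_def mpow_scaleR)

lemma mexp_0: "mexp (0 :: real ^ 'n ^ 'n) = mat 1"
  using suminf_finite[of "{0}" "\<lambda>k. (0 ^ k / fact k) *\<^sub>R mpow (0 :: real ^ 'n ^ 'n) k"]
    mexp_eq[of 0 "0 :: real ^ 'n ^ 'n"] by simp

lemma mexp_commute: "A ** mexp (t *\<^sub>R A) = mexp (t *\<^sub>R A) ** A"
proof -
  have "A ** mexp (t *\<^sub>R A) = (\<Sum>k. A ** ((t ^ k / fact k) *\<^sub>R mpow A k))"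
    unfolding mexp_eq by (rule bounded_linear.suminf[OF matrix_mult.bounded_linear_right summable_mexp])
  also have "\<dots> = (\<Sum>k. ((t ^ k / fact k) *\<^sub>R mpow A k) ** A)"
    by (simp only: matrix_mult.scaleR_left matrix_mult.scaleR_right mpow_commute)
  also have "\<dots> = mexp (t *\<^sub>R A) ** A"
    unfolding mexp_eq by (rule bounded_linear.suminf[OF matrix_mult.bounded_linear_left summable_mexp, symmetric])
  finally show ?thesis .
qed

lemma mexp_entry: "mexp (t *\<^sub>R A) $ i $ j = (\<Sum>k. (mpow A k $ i $ j / fact k) * t ^ k)"
  and summable_mexp_entry: "summable (\<lambda>k. (mpow A k $ i $ j / fact k) * t ^ k)"
proof -
  have bl: "bounded_linear (\<lambda>Y :: real ^ 'a ^ 'a. Y $ i $ j)"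
    by (rule bounded_linear_compose[OF bounded_linear_vec_nth bounded_linear_vec_nth])
  show "mexp (t *\<^sub>R A) $ i $ j = (\<Sum>k. (mpow A k $ i $ j / fact k) * t ^ k)"
    unfolding mexp_eq bounded_linear.suminf[OF bl summable_mexp] by (simp add: mult.commute)
  show "summable (\<lambda>k. (mpow A k $ i $ j / fact k) * t ^ k)"
    using bounded_linear.summable[OF bl summable_mexp, of t A] by (simp add: mult.commute)
qed

text \<open>Each entry is a power series in \<open>t\<close> that converges everywhere, and shifting the coefficients
  \<open>A\<^sup>k / k!\<close> amounts to a multiplication by \<open>A\<close>.\<close>

lemma mexp_entry_derivative:
  "((\<lambda>t. mexp (t *\<^sub>R A) $ i $ j) has_real_derivative (A ** mexp (t *\<^sub>R A)) $ i $ j) (at t)"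
proof -
  have bl: "bounded_linear (\<lambda>Y :: real ^ 'a ^ 'a. (A ** Y) $ i $ j)"
    by (intro bounded_linear_compose[OF bounded_linear_vec_nth]
        bounded_linear_compose[OF bounded_linear_vec_nth] matrix_mult.bounded_linear_right)
  have "diffs (\<lambda>k. mpow A k $ i $ j / fact k) k * t ^ k = (A ** ((t ^ k / fact k) *\<^sub>R mpow A k)) $ i $ j" for k
    by (simp add: diffs_def matrix_mult.scaleR_right fact_Suc divide_simps)
  then have "(\<Sum>k. diffs (\<lambda>k. mpow A k $ i $ j / fact k) k * t ^ k) = (A ** mexp (t *\<^sub>R A)) $ i $ j"
    unfolding mexp_eq bounded_linear.suminf[OF bl summable_mexp] by simp
  with termdiffs_strong_converges_everywhere[OF summable_mexp_entry[of A i j], of t]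
  show ?thesis by (simp add: mexp_entry)
qed

lemma matrix_expansion:
  "Y = (\<Sum>i\<in>UNIV. \<Sum>j\<in>UNIV. Y $ i $ j *\<^sub>R axis i (axis j 1))" for Y :: "real ^ 'b ^ 'a"
proof -
  have "(\<Sum>x\<in>UNIV. \<Sum>z\<in>UNIV. Y $ x $ z *\<^sub>R axis x (axis z (1 :: real))) $ i $ j = Y $ i $ j" for i j
  proof -
    have "(\<Sum>x\<in>UNIV. \<Sum>z\<in>UNIV. Y $ x $ z *\<^sub>R axis x (axis z (1 :: real))) $ i $ j
        = (\<Sum>x\<in>UNIV. if i = x then (\<Sum>z\<in>UNIV. if j = z then Y $ x $ z else 0) else 0)"
      by (simp only: sum_component vector_scaleR_component, intro sum.cong refl) (auto simp: axis_def intro!: sum.cong simp del: sum.delta sum.delta')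
    also have "\<dots> = Y $ i $ j" by simp
    finally show ?thesis .
  qed
  then show ?thesis by (simp add: vec_eq_iff)
qed

lemma has_vector_derivative_matrix:
  fixes f :: "real \<Rightarrow> real ^ 'b ^ 'a"
  assumes "\<And>i j. ((\<lambda>t. f t $ i $ j) has_real_derivative f' $ i $ j) (at t)"
  shows "(f has_vector_derivative f') (at t)"
proof -
  have "((\<lambda>t. \<Sum>i\<in>UNIV. \<Sum>j\<in>UNIV. f t $ i $ j *\<^sub>R axis i (axis j 1 :: real ^ 'b)) has_vector_derivative
      (\<Sum>i\<in>UNIV. \<Sum>j\<in>UNIV. f' $ i $ j *\<^sub>R axis i (axis j 1))) (at t)"
    using assms
    by (intro has_vector_derivative_sum)
       (auto intro!: derivative_eq_intros simp: has_real_derivative_iff_has_vector_derivative)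
  then show ?thesis by (simp only: matrix_expansion[symmetric])
qed

lemma mexp_derivative:
  "((\<lambda>t. mexp (t *\<^sub>R A)) has_vector_derivative A ** mexp (t *\<^sub>R A)) (at t within S)"
  by (rule has_vector_derivative_at_within[OF has_vector_derivative_matrix[OF mexp_entry_derivative]])

lemma continuous_on_mexp: "continuous_on S (\<lambda>t. mexp (t *\<^sub>R A))"
  by (rule continuous_on_vector_derivative[OF mexp_derivative])

text \<open>The solution of \<open>y' = A\<^sup>T y\<close>, \<open>y 0 = x\<close>. The transposed system is the relevant one because a kernel
  with leading factor \<open>e\<^sup>A\<^sup>t\<close> is tested against a fixed vector \<open>x\<close>.\<close>

abbreviation flow :: "real ^ 'n ^ 'n \<Rightarrow> real ^ 'n \<Rightarrow> real \<Rightarrow> real ^ 'n" where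
  "flow A x t \<equiv> x v* mexp (t *\<^sub>R A)"

lemma flow_0: "flow A x 0 = x"
  by (simp add: mexp_0 vector_matrix_mul_rid)

lemma flow_derivative: "(flow A x has_vector_derivative flow A x t v* A) (at t within S)"
  using bounded_linear.has_vector_derivative[OF vector_matrix.bounded_linear_right mexp_derivative, of x A t S]
  by (simp add: mexp_commute vector_matrix_mul_assoc)

lemma continuous_on_flow: "continuous_on S (flow A x)"
  by (rule continuous_on_vector_derivative[OF flow_derivative])

lemma qform_flow_derivative:
  assumes "transpose P = P"
  shows "((\<lambda>t. qform P (flow A x t)) has_real_derivative
    qform (A ** P + P ** transpose A) (flow A x t)) (at t)"
proof -
  let ?y = "flow A x"
  have "((\<lambda>t. P *v ?y t) has_vector_derivative P *v (?y t v* A)) (at t)"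
    by (rule bounded_linear.has_vector_derivative[OF matrix_vector.bounded_linear_right flow_derivative])
  from bounded_bilinear.has_vector_derivative[OF bounded_bilinear_inner flow_derivative this]
  have "((\<lambda>t. qform P (?y t)) has_vector_derivative
      ?y t \<bullet> (P *v (?y t v* A)) + (?y t v* A) \<bullet> (P *v ?y t)) (at t)"
    by (simp add: qform_def)
  moreover have "?y t \<bullet> (P *v (?y t v* A)) + (?y t v* A) \<bullet> (P *v ?y t)
      = qform (A ** P + P ** transpose A) (?y t)"
    by (simp add: qform_add, simp add: qform_def matrix_vector_mul_assoc[symmetric] inner_matrix_vector[of _ A])
  ultimately show ?thesis by (simp add: has_real_derivative_iff_has_vector_derivative)
qed

section \<open>Stability parameters yield a Lyapunov certificate\<close>

lemma norm_matrix_vector_le_spectral: "norm (D *v x) \<le> spectral_norm D * norm x"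
  unfolding spectral_norm_def by (rule onorm[OF matrix_vector.bounded_linear_right])

lemma spectral_norm_nonneg: "0 \<le> spectral_norm D"
  unfolding spectral_norm_def by (rule onorm_pos_le[OF matrix_vector.bounded_linear_right])

text \<open>A matrix and its transpose have the same spectral norm, by Cauchy-Schwarz at \<open>x v* D\<close>.\<close>

lemma norm_vector_matrix_le_spectral: "norm (x v* D) \<le> spectral_norm D * norm x"
proof (cases "x v* D = 0")
  case True
  then show ?thesis using spectral_norm_nonneg[of D] by simp
next
  case False
  have "norm (x v* D) * norm (x v* D) = x \<bullet> (D *v (x v* D))"
    by (simp add: inner_matrix_vector dot_square_norm power2_eq_square)
  also have "\<dots> \<le> norm x * norm (D *v (x v* D))"
    by (rule norm_cauchy_schwarz)
  also have "\<dots> \<le> norm x * (spectral_norm D * norm (x v* D))"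
    by (intro mult_left_mono norm_matrix_vector_le_spectral) simp
  finally show ?thesis using False by (simp add: mult.commute mult.left_commute)
qed

lemma sum_norm_blocks: "(\<Sum>k\<in>UNIV. (norm (x v* N $ k))\<^sup>2) = (norm (x v* hcat N))\<^sup>2"
proof -
  have "(\<Sum>k\<in>UNIV. (norm (x v* N $ k))\<^sup>2) = (\<Sum>k\<in>UNIV. \<Sum>b\<in>UNIV. ((x v* hcat N) $ (k, b))\<^sup>2)"
    unfolding power2_norm_eq_inner inner_vec_def
    by (simp add: power2_eq_square vector_matrix_mult_def hcat_def)
  also have "\<dots> = (norm (x v* hcat N))\<^sup>2"
    unfolding power2_norm_eq_inner inner_vec_def
    by (simp add: sum.cartesian_product power2_eq_square split_def)
  finally show ?thesis .
qed

text \<open>\<open>Q\<close> is the integral of \<open>e\<^sup>A\<^sup>t (e\<^sup>A\<^sup>t)\<^sup>T\<close> over \<open>[0, T]\<close>. The integrand satisfies \<open>G' = A G + G A\<^sup>T\<close>, so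
  integrating gives the equation with the boundary terms on the right; the norm bound is the
  integral of \<open>\<beta>\<^sup>2 e\<^sup>-\<^sup>2\<^sup>\<alpha>\<^sup>t\<close>.\<close>

lemma truncated_gramian:
  fixes A :: "real ^ 'n ^ 'n"
  assumes \<alpha>: "0 < \<alpha>" and bound: "\<And>t. 0 \<le> t \<Longrightarrow> spectral_norm (mexp (t *\<^sub>R A)) \<le> \<beta> * exp (- \<alpha> * t)"
    and T: "0 \<le> T"
  obtains Q where "psd Q" "A ** Q + Q ** transpose A = mexp (T *\<^sub>R A) ** transpose (mexp (T *\<^sub>R A)) - mat 1"
    "\<And>x. qform Q x \<le> \<beta>\<^sup>2 / (2 * \<alpha>) * (norm x)\<^sup>2"
proof
  define G where "G t = mexp (t *\<^sub>R A) ** transpose (mexp (t *\<^sub>R A))" for t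
  define Q where "Q = integral {0..T} G"
  have G': "(G has_vector_derivative A ** G t + G t ** transpose A) (at t within S)" for t S
  proof -
    note d = mexp_derivative[of A t S]
    show ?thesis
      using bounded_bilinear.has_vector_derivative[OF bounded_bilinear_matrix_mult d
          bounded_linear.has_vector_derivative[OF bounded_linear_transpose d]]
      by (simp add: G_def[abs_def] matrix_transpose_mul matrix_mul_assoc add.commute)
  qed
  have Q: "(G has_integral Q) {0..T}"
    unfolding Q_def
    by (intro integrable_integral integrable_continuous_interval continuous_on_vector_derivative[OF G'])
  have qG: "qform (G t) x = (norm (flow A x t))\<^sup>2" for t x
    by (simp add: G_def qform_gram dot_square_norm)
  have qG_le: "qform (G t) x \<le> \<beta>\<^sup>2 * exp (- (2 * \<alpha>) * t) * (norm x)\<^sup>2" if "0 \<le> t" for t x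
  proof -
    have "norm (flow A x t) \<le> \<beta> * exp (- \<alpha> * t) * norm x"
      by (rule order_trans[OF norm_vector_matrix_le_spectral mult_right_mono[OF bound[OF that]]]) simp
    then have "(norm (flow A x t))\<^sup>2 \<le> (\<beta> * exp (- \<alpha> * t) * norm x)\<^sup>2"
      by (intro power_mono) auto
    also have "\<dots> = \<beta>\<^sup>2 * exp (- (2 * \<alpha>) * t) * (norm x)\<^sup>2"
      by (simp add: power_mult_distrib exp_double[symmetric] mult.assoc)
    finally show ?thesis by (simp add: qG)
  qed
  have bl: "bounded_linear (\<lambda>Y. qform Y x)" for x :: "real ^ 'n"
    unfolding qform_def
    by (intro bounded_linear_compose[OF bounded_linear_inner_right] matrix_vector.bounded_linear_left)
  have qQ: "((\<lambda>t. qform (G t) x) has_integral qform Q x) {0..T}" for x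
    using has_integral_linear[OF Q bl] by (simp add: o_def)
  have "transpose Q = Q"
  proof (rule has_integral_unique)
    have "transpose (G t) = G t" for t by (simp add: G_def matrix_transpose_mul)
    then show "(G has_integral transpose Q) {0..T}"
      using has_integral_linear[OF Q bounded_linear_transpose] by (simp add: o_def)
  qed (rule Q)
  moreover have "0 \<le> qform Q x" for x
    by (rule has_integral_nonneg[OF qQ]) (simp add: qG)
  ultimately show "psd Q" by (simp add: psd_def)
  have "((\<lambda>t. A ** G t + G t ** transpose A) has_integral A ** Q + Q ** transpose A) {0..T}"
    using has_integral_linear[OF Q bounded_linear_add[OF matrix_mult.bounded_linear_right[of A]
          matrix_mult.bounded_linear_left[of "transpose A"]]]
    by (simp add: o_def)
  moreover have "((\<lambda>t. A ** G t + G t ** transpose A) has_integral G T - G 0) {0..T}"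
    by (rule fundamental_theorem_of_calculus[OF T G'])
  ultimately have "A ** Q + Q ** transpose A = G T - G 0" by (rule has_integral_unique)
  then show "A ** Q + Q ** transpose A = mexp (T *\<^sub>R A) ** transpose (mexp (T *\<^sub>R A)) - mat 1"
    by (simp add: G_def mexp_0)
  show "qform Q x \<le> \<beta>\<^sup>2 / (2 * \<alpha>) * (norm x)\<^sup>2" for x
  proof -
    define F where "F t = - (\<beta>\<^sup>2 / (2 * \<alpha>) * exp (- (2 * \<alpha>) * t) * (norm x)\<^sup>2)" for t
    have "(F has_real_derivative \<beta>\<^sup>2 * exp (- (2 * \<alpha>) * t) * (norm x)\<^sup>2) (at t within {0..T})" for t
      unfolding F_def using \<alpha> by (auto intro!: derivative_eq_intros simp: field_simps)
    then have "((\<lambda>t. \<beta>\<^sup>2 * exp (- (2 * \<alpha>) * t) * (norm x)\<^sup>2) has_integral F T - F 0) {0..T}"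
      by (intro fundamental_theorem_of_calculus[OF T])
         (simp add: has_real_derivative_iff_has_vector_derivative)
    from has_integral_le[OF qQ[of x] this] have "qform Q x \<le> F T - F 0"
      by (simp add: qG_le[simplified])
    also have "\<dots> \<le> \<beta>\<^sup>2 / (2 * \<alpha>) * (norm x)\<^sup>2"
      using \<alpha> by (simp add: F_def)
    finally show ?thesis .
  qed
qed

text \<open>For the truncated Gramian, the drift terms contribute \<open>-|x|\<^sup>2\<close> up to the boundary term at \<open>T\<close>, and
  the coupling terms at most \<open>\<theta> |x|\<^sup>2\<close> with \<open>\<theta> = \<beta>\<^sup>2 \<parallel>[N\<^sub>1 \<dots> N\<^sub>m]\<parallel>\<^sup>2 / (2 \<alpha>) < 1\<close>. A large \<open>T\<close> makes the
  boundary term consume only half of the gap \<open>1 - \<theta>\<close>.\<close>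

theorem lyap_certificate_exists:
  fixes A :: "real ^ 'n ^ 'n"
  assumes sp: "stability_params A \<alpha> \<beta>" and N: "(spectral_norm (hcat N))\<^sup>2 < 2 * \<alpha> / \<beta>\<^sup>2"
  obtains Q where "lyap_certificate A N Q"
proof -
  define \<theta> where "\<theta> = \<beta>\<^sup>2 / (2 * \<alpha>) * (spectral_norm (hcat N))\<^sup>2"
  have \<alpha>: "0 < \<alpha>" and \<beta>: "0 < \<beta>"
    and bound: "\<And>t. 0 \<le> t \<Longrightarrow> spectral_norm (mexp (t *\<^sub>R A)) \<le> \<beta> * exp (- \<alpha> * t)"
    using sp by (simp_all add: stability_params_def)
  have \<theta>: "\<theta> < 1"
    using N \<alpha> \<beta> by (simp add: \<theta>_def field_simps)
  \<comment> \<open>With \<open>2 \<alpha> T = z\<close>, the estimate \<open>z \<le> e\<^sup>z\<close> gives the decay required below.\<close>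
  define T where "T = (2 * \<beta>\<^sup>2 / (1 - \<theta>)) / (2 * \<alpha>)"
  have T: "0 \<le> T" using \<theta> \<alpha> by (simp add: T_def)
  have "2 * \<beta>\<^sup>2 / (1 - \<theta>) \<le> exp (2 * \<alpha> * T)"
    using order_trans[OF _ exp_ge_add_one_self, of "2 * \<beta>\<^sup>2 / (1 - \<theta>)"] \<alpha> by (simp add: T_def)
  then have decay: "\<beta>\<^sup>2 * exp (- (2 * \<alpha>) * T) \<le> (1 - \<theta>) / 2"
    using \<theta> by (simp add: exp_minus field_simps)
  obtain Q where Q: "psd Q" "A ** Q + Q ** transpose A = mexp (T *\<^sub>R A) ** transpose (mexp (T *\<^sub>R A)) - mat 1"
    "\<And>x. qform Q x \<le> \<beta>\<^sup>2 / (2 * \<alpha>) * (norm x)\<^sup>2"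
    using truncated_gramian[OF \<alpha> bound T] by blast
  have "qform (lyap A N Q) x \<le> - ((1 - \<theta>) / 2) * (x \<bullet> x)" for x
  proof -
    have "norm (flow A x T) \<le> \<beta> * exp (- \<alpha> * T) * norm x"
      by (rule order_trans[OF norm_vector_matrix_le_spectral mult_right_mono[OF bound[OF T]]]) simp
    then have "(norm (flow A x T))\<^sup>2 \<le> (\<beta> * exp (- \<alpha> * T) * norm x)\<^sup>2"
      by (intro power_mono) auto
    also have "\<dots> = \<beta>\<^sup>2 * exp (- (2 * \<alpha>) * T) * (norm x)\<^sup>2"
      by (simp add: power_mult_distrib exp_double[symmetric] mult.assoc)
    also have "\<dots> \<le> (1 - \<theta>) / 2 * (norm x)\<^sup>2"
      by (intro mult_right_mono decay) simp
    finally have 1: "qform (A ** Q + Q ** transpose A) x \<le> (1 - \<theta>) / 2 * (norm x)\<^sup>2 - (norm x)\<^sup>2"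
      by (simp add: Q(2) qform_diff qform_gram dot_square_norm)
    have "(\<Sum>k\<in>UNIV. qform Q (x v* N $ k)) \<le> (\<Sum>k\<in>UNIV. \<beta>\<^sup>2 / (2 * \<alpha>) * (norm (x v* N $ k))\<^sup>2)"
      by (intro sum_mono Q(3))
    also have "\<dots> = \<beta>\<^sup>2 / (2 * \<alpha>) * (norm (x v* hcat N))\<^sup>2"
      by (simp only: sum_distrib_left[symmetric] sum_norm_blocks)
    also have "\<dots> \<le> \<beta>\<^sup>2 / (2 * \<alpha>) * (spectral_norm (hcat N) * norm x)\<^sup>2"
      using \<alpha> by (intro mult_left_mono power_mono norm_vector_matrix_le_spectral) auto
    also have "\<dots> = \<theta> * (norm x)\<^sup>2"
      by (simp add: \<theta>_def power_mult_distrib)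
    finally have 2: "(\<Sum>k\<in>UNIV. qform Q (x v* N $ k)) \<le> \<theta> * (norm x)\<^sup>2" .
    have "qform (lyap A N Q) x = qform (A ** Q + Q ** transpose A) x + (\<Sum>k\<in>UNIV. qform Q (x v* N $ k))"
      by (simp add: sylvester_def qform_add qform_sum qform_congruence)
    also have "\<dots> \<le> - ((1 - \<theta>) / 2) * (norm x)\<^sup>2"
      using 1 2 by (simp add: field_simps)
    finally show ?thesis by (simp add: dot_square_norm)
  qed
  with Q(1) \<theta> have "lyap_certificate A N Q"
    unfolding lyap_certificate_def by (intro conjI exI[of _ "(1 - \<theta>) / 2"]) auto
  then show ?thesis by (rule that)
qed

section \<open>Quadratic forms along the flow\<close>

abbreviation half_line :: "real measure" where
  "half_line \<equiv> restrict_space lborel {0..}"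

lemma qform_le_norm: "\<exists>K>0. \<forall>x. qform D x \<le> K * (x \<bullet> x)" for D :: "real ^ 'n ^ 'n"
proof -
  obtain K where K: "\<And>(D :: real ^ 'n ^ 'n) x. \<bar>qform D x\<bar> \<le> K * norm D * (x \<bullet> x)"
    using qform_bounded by blast
  have "qform D x \<le> (\<bar>K * norm D\<bar> + 1) * (x \<bullet> x)" for x
  proof -
    have "K * norm D * (x \<bullet> x) \<le> (\<bar>K * norm D\<bar> + 1) * (x \<bullet> x)"
      by (intro mult_right_mono) auto
    then show ?thesis using K[of D x] by linarith
  qed
  then show ?thesis by (intro exI[of _ "\<bar>K * norm D\<bar> + 1"]) auto
qed

text \<open>For large \<open>\<kappa>\<close> the operator is nonpositive at \<open>\<kappa> Q - P\<close>, and the comparison principle applies.\<close>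

lemma lyap_certificate_dominates:
  fixes A :: "real ^ 'n ^ 'n"
  assumes cert: "lyap_certificate A N Q" and P: "transpose P = P"
  shows "\<exists>\<kappa>\<ge>0. \<forall>x. qform P x \<le> \<kappa> * qform Q x"
proof -
  obtain c where c: "c > 0" "\<And>x. qform (lyap A N Q) x \<le> - c * (x \<bullet> x)"
    using cert unfolding lyap_certificate_def by blast
  obtain K where K: "K > 0" "\<And>x. qform (- lyap A N P) x \<le> K * (x \<bullet> x)"
    using qform_le_norm by blast
  have Q: "transpose Q = Q" using cert by (simp add: lyap_certificate_def psd_def)
  have "psd ((K / c) *\<^sub>R Q - P)"
  proof (rule lyap_comparison[OF cert])
    show "transpose ((K / c) *\<^sub>R Q - P) = (K / c) *\<^sub>R Q - P"
      by (simp add: transpose_linear_simps transpose_scalar P Q)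
    fix x
    have "(K / c) * qform (lyap A N Q) x \<le> (K / c) * (- c * (x \<bullet> x))"
      using K(1) c by (intro mult_left_mono) auto
    also have "\<dots> = - (K * (x \<bullet> x))" using c(1) by simp
    finally show "qform (lyap A N ((K / c) *\<^sub>R Q - P)) x \<le> 0"
      using K(2)[of x] qform_diff[of 0 "lyap A N P" x]
      by (simp add: linear_diff[OF linear_sylvester] linear_scale[OF linear_sylvester]
          qform_diff qform_scaleR)
  qed
  then have "qform P x \<le> (K / c) * qform Q x" for x
    using psd_nonneg[of _ x] by (fastforce simp: qform_diff qform_scaleR)
  then show ?thesis using K(1) c(1) by (intro exI[of _ "K / c"]) auto
qed

lemma qform_drift:
  "qform (A ** P + P ** transpose A) x = qform (lyap A N P) x - (\<Sum>k\<in>UNIV. qform P (x v* N $ k))"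
  by (simp add: sylvester_def qform_add qform_sum qform_congruence)

lemma certificate_drift:
  assumes "lyap_certificate A N Q"
  obtains c where "c > 0" "\<And>x. qform (A ** Q + Q ** transpose A) x \<le> - c * (x \<bullet> x)"
proof -
  obtain c where c: "c > 0" "\<And>x. qform (lyap A N Q) x \<le> - c * (x \<bullet> x)"
    using assms unfolding lyap_certificate_def by blast
  have "0 \<le> (\<Sum>k\<in>UNIV. qform Q (x v* N $ k))" for x
    using assms by (intro sum_nonneg) (simp add: lyap_certificate_def psd_nonneg)
  note nonneg = this
  have "qform (A ** Q + Q ** transpose A) x \<le> - c * (x \<bullet> x)" for x
    unfolding qform_drift[of A Q x N] using nonneg[of x] c(2)[of x] by linarith
  with c(1) show ?thesis by (rule that)
qed

text \<open>The form of \<open>Q\<close> decreases along the flow at a rate that is at least proportional to \<open>|y|\<^sup>2\<close>, hence to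
  the form itself, so it decays exponentially.\<close>

lemma certificate_flow_tendsto_0:
  assumes cert: "lyap_certificate A N Q"
  shows "((\<lambda>t. qform Q (flow A x t)) \<longlongrightarrow> 0) at_top"
proof -
  have Q: "psd Q" using cert by (simp add: lyap_certificate_def)
  obtain c where c: "c > 0" "\<And>x. qform (A ** Q + Q ** transpose A) x \<le> - c * (x \<bullet> x)"
    using certificate_drift[OF cert] by blast
  obtain K where K: "K > 0" "\<And>x. qform Q x \<le> K * (x \<bullet> x)"
    using qform_le_norm by blast
  define r where "r = c / K"
  have r: "r > 0" using c K by (simp add: r_def)
  define f where "f t = exp (r * t) * qform Q (flow A x t)" for t
  have "f t \<le> f 0" if "0 \<le> t" for t
  proof (rule DERIV_nonpos_imp_nonincreasing[OF that])
    fix s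
    let ?y = "flow A x s"
    have "(f has_real_derivative exp (r * s) * (r * qform Q ?y + qform (A ** Q + Q ** transpose A) ?y)) (at s)"
      unfolding f_def
      by (rule derivative_eq_intros qform_flow_derivative psd_transpose Q refl)+
         (simp add: algebra_simps)
    moreover have "r * qform Q ?y + qform (A ** Q + Q ** transpose A) ?y \<le> 0"
    proof -
      have "r * qform Q ?y \<le> r * (K * (?y \<bullet> ?y))"
        using r K(2) by (intro mult_left_mono) auto
      also have "\<dots> = c * (?y \<bullet> ?y)" using K(1) by (simp add: r_def)
      finally show ?thesis using c(2)[of ?y] by simp
    qed
    ultimately show "\<exists>y. (f has_real_derivative y) (at s) \<and> y \<le> 0"
      by (meson exp_ge_zero mult_nonneg_nonpos)
  qed
  then have "f t * exp (- (r * t)) \<le> f 0 * exp (- (r * t))" if "0 \<le> t" for t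
    using that by (intro mult_right_mono) auto
  moreover have "f t * exp (- (r * t)) = qform Q (flow A x t)" for t
    by (simp add: f_def exp_minus)
  ultimately have "qform Q (flow A x t) \<le> f 0 * exp (- (r * t))" if "0 \<le> t" for t
    using that by metis
  then have le: "\<forall>\<^sub>F t in at_top. qform Q (flow A x t) \<le> f 0 * exp (- (r * t))"
    unfolding eventually_at_top_linorder by blast
  have ge: "\<forall>\<^sub>F t in at_top. 0 \<le> qform Q (flow A x t)"
    using psd_nonneg[OF Q] by (intro always_eventually allI)
  have "filterlim (\<lambda>t. r * t) at_top at_top"
    by (rule filterlim_tendsto_pos_mult_at_top[OF tendsto_const r filterlim_ident])
  then have "((\<lambda>t. exp (- (r * t))) \<longlongrightarrow> 0) at_top"
    by (intro filterlim_compose[OF exp_at_bot]) (simp add: filterlim_uminus_at_bot)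
  then have "((\<lambda>t. f 0 * exp (- (r * t))) \<longlongrightarrow> 0) at_top"
    by (rule tendsto_mult_right_zero)
  from tendsto_sandwich[OF ge le tendsto_const this] show ?thesis .
qed

lemma qform_flow_tendsto_0:
  assumes cert: "lyap_certificate A N Q" and P: "psd P"
  shows "((\<lambda>t. qform P (flow A x t)) \<longlongrightarrow> 0) at_top"
proof -
  obtain \<kappa> where \<kappa>: "\<And>x. qform P x \<le> \<kappa> * qform Q x"
    using lyap_certificate_dominates[OF cert psd_transpose[OF P]] by blast
  have lim: "((\<lambda>t. \<kappa> * qform Q (flow A x t)) \<longlongrightarrow> 0) at_top"
    by (rule tendsto_mult_right_zero[OF certificate_flow_tendsto_0[OF cert]])
  have ge: "\<forall>\<^sub>F t in at_top. 0 \<le> qform P (flow A x t)"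
    using psd_nonneg[OF P] by (intro always_eventually allI)
  have le: "\<forall>\<^sub>F t in at_top. qform P (flow A x t) \<le> \<kappa> * qform Q (flow A x t)"
    using \<kappa> by (intro always_eventually allI)
  from tendsto_sandwich[OF ge le tendsto_const lim] show ?thesis .
qed

text \<open>The integrand is minus the derivative of the form of \<open>P\<close> along the flow, and that form vanishes at
  infinity because \<open>Q\<close> dominates it.\<close>

lemma nn_integral_flow:
  assumes cert: "lyap_certificate A N Q" and P: "psd P"
    and neg: "\<And>y. qform (A ** P + P ** transpose A) y \<le> 0"
  shows "(\<integral>\<^sup>+t. ennreal (- qform (A ** P + P ** transpose A) (flow A x t)) \<partial>half_line) = ennreal (qform P x)"
proof -
  define g where "g t = - qform (A ** P + P ** transpose A) (flow A x t)" for t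
  have "continuous_on UNIV g"
    unfolding g_def by (intro continuous_intros continuous_on_compose2[OF continuous_on_qform continuous_on_flow]) auto
  then have meas: "g \<in> borel_measurable borel" by (rule borel_measurable_continuous_onI)
  have der: "((\<lambda>t. - qform P (flow A x t)) has_real_derivative g t) (at t)" for t
    unfolding g_def by (intro derivative_intros qform_flow_derivative psd_transpose P)
  have lim: "((\<lambda>t. - qform P (flow A x t)) \<longlongrightarrow> 0) at_top"
    using tendsto_minus[OF qform_flow_tendsto_0[OF cert P]] by simp
  have "(\<integral>\<^sup>+t. ennreal (g t) \<partial>half_line) = (\<integral>\<^sup>+t. ennreal (g t) * indicator {0..} t \<partial>lborel)"
    by (rule nn_integral_restrict_space) simp
  also have "\<dots> = ennreal (0 - - qform P (flow A x 0))"
    by (rule nn_integral_FTC_atLeast[OF meas der _ lim]) (simp add: g_def neg)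
  finally show ?thesis by (simp add: g_def flow_0[simplified])
qed

section \<open>Energies of the kernels\<close>

definition kernel_col :: "real ^ 'n ^ 'n \<Rightarrow> real ^ 'm ^ 'n \<Rightarrow> real ^ 'n ^ 'n ^ 'm \<Rightarrow> nat \<Rightarrow> (nat \<Rightarrow> real)
    \<Rightarrow> 'm list \<Rightarrow> real ^ 'n" where
  "kernel_col A B N i t w = (\<chi> a. Pbar A B N i t a w)"

definition kernel_power :: "real ^ 'n ^ 'n \<Rightarrow> real ^ 'm ^ 'n \<Rightarrow> real ^ 'n ^ 'n ^ 'm \<Rightarrow> nat \<Rightarrow> real ^ 'n
    \<Rightarrow> (nat \<Rightarrow> real) \<Rightarrow> real" where
  "kernel_power A B N i x t = (\<Sum>w\<in>words i. (x \<bullet> kernel_col A B N i t w)\<^sup>2)"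

text \<open>For varying \<open>x\<close> this is the quadratic form of the contribution of level \<open>i\<close> to the Gramian. As an
  extended number it is defined without integrability, and exchanging sums and integrals requires
  measurability only.\<close>

definition kernel_energy :: "real ^ 'n ^ 'n \<Rightarrow> real ^ 'm ^ 'n \<Rightarrow> real ^ 'n ^ 'n ^ 'm \<Rightarrow> nat \<Rightarrow> real ^ 'n
    \<Rightarrow> ennreal" where
  "kernel_energy A B N i x = (\<integral>\<^sup>+t. ennreal (kernel_power A B N i x t) \<partial>time_measure i)"

lemma kernel_power_nonneg: "0 \<le> kernel_power A B N i x t"
  by (simp add: kernel_power_def sum_nonneg)

lemma sum_words_Suc:
  "(\<Sum>w\<in>words (Suc i). f w) = (\<Sum>k\<in>(UNIV :: 'm::finite set). \<Sum>w\<in>words i. f (k # w))"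
proof -
  have "words (Suc i) = (\<lambda>(k :: 'm, w). k # w) ` (UNIV \<times> words i)"
    by (force simp: words_def length_Suc_conv)
  moreover have "inj_on (\<lambda>(k :: 'm, w). k # w) (UNIV \<times> words i)"
    by (auto simp: inj_on_def)
  ultimately show ?thesis
    by (simp add: sum.reindex sum.cartesian_product split_def)
qed

lemma words_0: "words 0 = {[]}"
  by (simp add: words_def)

lemma Pbar_cong:
  "(\<And>k. 1 \<le> k \<Longrightarrow> k \<le> i \<Longrightarrow> t k = t' k) \<Longrightarrow> Pbar A B N i t = Pbar A B N i t'"
proof (induction A B N i t rule: Pbar.induct)
  case (3 A B N i t)
  then have "Pbar A B N (Suc i) t = Pbar A B N (Suc i) t'" by simp
  with 3 show ?case by (simp del: One_nat_def)
qed simp_all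

lemma kernel_col_1:
  "x \<bullet> kernel_col A B N (Suc 0) t w = (flow A x (t 1) v* B) $ hd w"
proof -
  have "kernel_col A B N (Suc 0) t w = mexp (t 1 *\<^sub>R A) *v (B *v axis (hd w) 1)"
    by (simp add: kernel_col_def vec_eq_iff fmul_def entries_def matrix_vector_mult_basis column_def)
       (simp add: matrix_vector_mult_def)
  then show ?thesis by (simp add: inner_matrix_vector inner_axis)
qed

text \<open>The outermost time moves \<open>x\<close> along the flow, and the first letter of the word selects the \<open>N\<^sub>k\<close> that
  acts before the kernel of the previous level.\<close>

lemma kernel_col_Suc:
  "x \<bullet> kernel_col A B N (Suc (Suc i)) t w
    = (flow A x (t (Suc (Suc i))) v* N $ hd w) \<bullet> kernel_col A B N (Suc i) t (tl w)"
proof -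
  let ?E = "mexp (t (Suc (Suc i)) *\<^sub>R A)"
  have "Pbar A B N (Suc (Suc i)) t a w = (?E *v (N $ hd w *v kernel_col A B N (Suc i) t (tl w))) $ a" for a
  proof -
    have "Pbar A B N (Suc (Suc i)) t a w = (\<Sum>kb\<in>UNIV \<times> UNIV. (\<Sum>a'\<in>UNIV. ?E $ a $ a' * N $ fst kb $ a' $ snd kb)
        * ((if fst kb = hd w then 1 else 0) * Pbar A B N (Suc i) t (snd kb) (tl w)))"
      by (simp add: fmul_def entries_def hcat_def kron_def mat_def split_def)
    also have "\<dots> = (\<Sum>k\<in>UNIV. \<Sum>b\<in>UNIV. (\<Sum>a'\<in>UNIV. ?E $ a $ a' * N $ k $ a' $ b)
        * ((if k = hd w then 1 else 0) * Pbar A B N (Suc i) t b (tl w)))"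
      by (simp only: sum.cartesian_product split_def)
    also have "\<dots> = (\<Sum>k\<in>UNIV. if k = hd w then \<Sum>b\<in>UNIV. (\<Sum>a'\<in>UNIV. ?E $ a $ a' * N $ k $ a' $ b)
        * Pbar A B N (Suc i) t b (tl w) else 0)"
      by (intro sum.cong) auto
    also have "\<dots> = (\<Sum>b\<in>UNIV. (\<Sum>a'\<in>UNIV. ?E $ a $ a' * N $ hd w $ a' $ b) * Pbar A B N (Suc i) t b (tl w))"
      by simp
    also have "\<dots> = ((?E ** N $ hd w) *v kernel_col A B N (Suc i) t (tl w)) $ a"
      by (simp add: matrix_vector_mult_def matrix_matrix_mult_def kernel_col_def)
    finally show ?thesis by (simp add: matrix_vector_mul_assoc)
  qed
  then have "kernel_col A B N (Suc (Suc i)) t w = ?E *v (N $ hd w *v kernel_col A B N (Suc i) t (tl w))"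
    by (simp add: kernel_col_def[of A B N "Suc (Suc i)"] vec_eq_iff)
  then show ?thesis by (simp add: inner_matrix_vector)
qed

lemma kernel_power_1:
  "kernel_power A B N (Suc 0) x t = (flow A x (t 1) v* B) \<bullet> (flow A x (t 1) v* B)"
  by (simp add: kernel_power_def sum_words_Suc words_0 kernel_col_1)
     (simp add: inner_vec_def power2_eq_square)

lemma kernel_power_Suc:
  "kernel_power A B N (Suc (Suc i)) x t
    = (\<Sum>k\<in>UNIV. kernel_power A B N (Suc i) (flow A x (t (Suc (Suc i))) v* N $ k) t)"
  by (simp add: kernel_power_def sum_words_Suc[of _ "Suc i"] kernel_col_Suc)

lemma kernel_power_cong:
  "(\<And>k. 1 \<le> k \<Longrightarrow> k \<le> i \<Longrightarrow> t k = t' k) \<Longrightarrow> kernel_power A B N i x t = kernel_power A B N i x t'"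
  using Pbar_cong[of i t t' A B N] by (simp add: kernel_power_def kernel_col_def)

interpretation half_line: product_sigma_finite "\<lambda>_ :: nat. half_line"
  by (rule product_sigma_finite.intro, rule sigma_finite_measure_restrict_space[OF sigma_finite_lborel]) simp

lemma sigma_finite_time_measure: "sigma_finite_measure (time_measure i)"
  unfolding time_measure_def by (rule half_line.sigma_finite) simp

lemma measurable_time [measurable]:
  assumes "1 \<le> k" "k \<le> i"
  shows "(\<lambda>t. t k) \<in> borel_measurable (time_measure i)"
proof -
  have "(\<lambda>t. t k) \<in> measurable (time_measure i) half_line"
    unfolding time_measure_def using assms by (intro measurable_component_singleton) auto
  moreover have "(\<lambda>t. t) \<in> borel_measurable half_line"
    by (intro measurable_restrict_space1) simp
  ultimately show ?thesis by (rule measurable_compose)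
qed

lemma measurable_mexp_entry [measurable]: "(\<lambda>t. mexp (t *\<^sub>R A) $ a $ b) \<in> borel_measurable borel"
  by (intro borel_measurable_continuous_onI continuous_intros continuous_on_mexp)

text \<open>The recursion evaluates the kernel of level \<open>i\<close> at longer tuples of times, whence the second index
  \<open>j\<close>.\<close>

lemma measurable_Pbar:
  assumes "i \<le> j"
  shows "(\<lambda>t. Pbar A B N i t a w) \<in> borel_measurable (time_measure j)"
  using assms
proof (induction i arbitrary: a w rule: less_induct)
  case (less i)
  consider "i = 0" | "i = Suc 0" | i' where "i = Suc (Suc i')" by (metis not0_implies_Suc)
  then show ?case
  proof cases
    case 2
    have [measurable]: "(\<lambda>t. t (Suc 0)) \<in> borel_measurable (time_measure j)"
      using less.prems 2 by (intro measurable_time) auto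
    show ?thesis by (simp add: 2 fmul_def entries_def)
  next
    case 3
    have [measurable]: "(\<lambda>t. t (Suc (Suc i'))) \<in> borel_measurable (time_measure j)"
      using less.prems 3 by (intro measurable_time) auto
    have [measurable]: "(\<lambda>t. Pbar A B N (Suc i') t a w) \<in> borel_measurable (time_measure j)" for a w
      using less.prems 3 by (intro less.IH) auto
    show ?thesis by (simp add: 3 fmul_def entries_def kron_def split_def)
  qed simp
qed

lemma measurable_vec:
  fixes f :: "'x \<Rightarrow> real ^ 'n"
  assumes "\<And>a. (\<lambda>t. f t $ a) \<in> borel_measurable M"
  shows "f \<in> borel_measurable M"
  unfolding borel_measurable_euclidean_space[of f]
  using assms by (auto simp: Basis_vec_def inner_axis)

lemma measurable_kernel_col [measurable]:
  "(\<lambda>t. kernel_col A B N i t w) \<in> borel_measurable (time_measure i)"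
  by (intro measurable_vec) (simp add: kernel_col_def measurable_Pbar)

lemma measurable_kernel_power:
  "(\<lambda>(x, t). kernel_power A B N i x t) \<in> borel_measurable (borel \<Otimes>\<^sub>M time_measure i)"
  unfolding kernel_power_def by measurable

lemma measurable_kernel_energy [measurable]: "kernel_energy A B N i \<in> borel_measurable borel"
proof -
  interpret sigma_finite_measure "time_measure i" by (rule sigma_finite_time_measure)
  note measurable_kernel_power[measurable]
  have "(\<lambda>x. \<integral>\<^sup>+t. ennreal (kernel_power A B N i x t) \<partial>time_measure i) \<in> borel_measurable borel"
    by (intro borel_measurable_nn_integral) measurable
  then show ?thesis by (simp add: kernel_energy_def[abs_def])
qed

lemma measurable_flow [measurable]: "flow A x \<in> borel_measurable half_line"
  by (intro measurable_restrict_space1) (simp add: borel_measurable_continuous_onI continuous_on_flow)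

lemma measurable_vector_matrix [measurable]: "(\<lambda>x. x v* D) \<in> borel_measurable borel" for D :: "real ^ 'b ^ 'a"
  by (intro borel_measurable_continuous_onI linear_continuous_on vector_matrix.bounded_linear_left)

lemma measurable_matrix_vector [measurable]: "(\<lambda>x. D *v x) \<in> borel_measurable borel" for D :: "real ^ 'b ^ 'a"
  by (intro borel_measurable_continuous_onI linear_continuous_on matrix_vector.bounded_linear_right)

lemma kernel_energy_1:
  "kernel_energy A B N (Suc 0) x = (\<integral>\<^sup>+s. ennreal ((flow A x s v* B) \<bullet> (flow A x s v* B)) \<partial>half_line)"
proof -
  have "(\<lambda>s. ennreal ((flow A x s v* B) \<bullet> (flow A x s v* B))) \<in> borel_measurable half_line"
    by measurable
  from half_line.product_nn_integral_singleton[OF this, of 1] show ?thesis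
    by (simp add: kernel_energy_def kernel_power_1 time_measure_def)
qed

text \<open>Integrating the outermost time last leaves energies of the previous level, which does not see that
  time.\<close>

lemma kernel_energy_Suc:
  "kernel_energy A B N (Suc (Suc i)) x
    = (\<integral>\<^sup>+s. (\<Sum>k\<in>UNIV. kernel_energy A B N (Suc i) (flow A x s v* N $ k)) \<partial>half_line)"
proof -
  let ?I = "{1..Suc i}" and ?n = "Suc (Suc i)"
  have ins: "{1..?n} = insert ?n ?I" by auto
  note measurable_kernel_power[measurable]
  have "(\<lambda>t. ennreal (kernel_power A B N ?n x t)) \<in> borel_measurable (time_measure ?n)"
    by measurable
  then have m: "(\<lambda>t. ennreal (kernel_power A B N ?n x t)) \<in> borel_measurable (Pi\<^sub>M (insert ?n ?I) (\<lambda>_. half_line))"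
    by (simp only: time_measure_def ins)
  have "kernel_energy A B N ?n x
      = (\<integral>\<^sup>+s. \<integral>\<^sup>+t. ennreal (kernel_power A B N ?n x (t(?n := s))) \<partial>time_measure (Suc i) \<partial>half_line)"
    unfolding kernel_energy_def time_measure_def ins
    by (rule half_line.product_nn_integral_insert_rev[OF _ _ m]) auto
  also have "\<dots> = (\<integral>\<^sup>+s. \<integral>\<^sup>+t. (\<Sum>k\<in>UNIV. ennreal (kernel_power A B N (Suc i) (flow A x s v* N $ k) t))
      \<partial>time_measure (Suc i) \<partial>half_line)"
  proof -
    have "kernel_power A B N (Suc i) y (t(?n := s)) = kernel_power A B N (Suc i) y t" for y s t
      by (rule kernel_power_cong) auto
    then show ?thesis by (simp add: kernel_power_Suc kernel_power_nonneg sum_ennreal)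
  qed
  also have "\<dots> = (\<integral>\<^sup>+s. (\<Sum>k\<in>UNIV. kernel_energy A B N (Suc i) (flow A x s v* N $ k)) \<partial>half_line)"
    unfolding kernel_energy_def by (intro nn_integral_cong nn_integral_sum) measurable
  finally show ?thesis .
qed

text \<open>The partial sums are the iterates, started at zero, of the map whose fixed point is the quadratic
  form of the Gramian.\<close>

lemma kernel_energy_partial_sum:
  "(\<Sum>i<Suc n. kernel_energy A B N (Suc i) x)
    = (\<integral>\<^sup>+s. ennreal ((flow A x s v* B) \<bullet> (flow A x s v* B))
        + (\<Sum>k\<in>UNIV. \<Sum>i<n. kernel_energy A B N (Suc i) (flow A x s v* N $ k)) \<partial>half_line)"
proof -
  have "(\<Sum>i<Suc n. kernel_energy A B N (Suc i) x)
      = kernel_energy A B N (Suc 0) x + (\<Sum>i<n. kernel_energy A B N (Suc (Suc i)) x)"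
    by (rule sum.lessThan_Suc_shift)
  also have "(\<Sum>i<n. kernel_energy A B N (Suc (Suc i)) x)
      = (\<integral>\<^sup>+s. (\<Sum>i<n. \<Sum>k\<in>UNIV. kernel_energy A B N (Suc i) (flow A x s v* N $ k)) \<partial>half_line)"
    unfolding kernel_energy_Suc by (subst nn_integral_sum) simp_all
  also have "\<dots> = (\<integral>\<^sup>+s. (\<Sum>k\<in>UNIV. \<Sum>i<n. kernel_energy A B N (Suc i) (flow A x s v* N $ k)) \<partial>half_line)"
    by (subst sum.swap) simp
  finally show ?thesis
    unfolding kernel_energy_1 by (subst nn_integral_add) simp_all
qed

section \<open>The energies add up to the Gramian\<close>

text \<open>Along the flow, the form of the Gramian decreases exactly by the energy injected at the input plus
  its own values behind the couplings \<open>N\<^sub>k\<close>.\<close>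

lemma drift_of_solution:
  assumes "lyap A N P + B ** transpose B = 0"
  shows "- qform (A ** P + P ** transpose A) y = (y v* B) \<bullet> (y v* B) + (\<Sum>k\<in>UNIV. qform P (y v* N $ k))"
proof -
  have "lyap A N P = - (B ** transpose B)" using assms by (simp add: eq_neg_iff_add_eq_0)
  then have "qform (lyap A N P) y = - ((y v* B) \<bullet> (y v* B))"
    using qform_diff[of 0 "B ** transpose B" y] by (simp add: qform_gram)
  then show ?thesis using qform_drift[of A P y N] by simp
qed

text \<open>The decrease of \<open>Q\<close> along the flow integrates to the form of \<open>Q\<close> at \<open>x\<close>. By strictness of the
  certificate the coupling terms are at most a fraction \<open>\<theta> < 1\<close> of that decrease.\<close>

lemma certificate_contraction:
  fixes A :: "real ^ 'n ^ 'n"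
  assumes cert: "lyap_certificate A N Q"
  obtains \<theta> where "0 \<le> \<theta>" "\<theta> < 1"
    "\<And>x. (\<integral>\<^sup>+s. ennreal (\<Sum>k\<in>UNIV. qform Q (flow A x s v* N $ k)) \<partial>half_line) \<le> ennreal (\<theta> * qform Q x)"
proof -
  have Q: "psd Q" using cert by (simp add: lyap_certificate_def)
  obtain c where c: "c > 0" "\<And>x. qform (lyap A N Q) x \<le> - c * (x \<bullet> x)"
    using cert unfolding lyap_certificate_def by blast
  define S where "S = (\<Sum>k\<in>UNIV. N $ k ** Q ** transpose (N $ k))"
  obtain K where K: "K > 0" "\<And>x. qform S x \<le> K * (x \<bullet> x)"
    using qform_le_norm by blast
  have S: "qform S x = (\<Sum>k\<in>UNIV. qform Q (x v* N $ k))" for x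
    by (simp add: S_def qform_sum qform_congruence)
  then have S_nonneg: "0 \<le> qform S x" for x by (simp add: sum_nonneg psd_nonneg[OF Q])
  define D where "D x = - qform (A ** Q + Q ** transpose A) x" for x
  have D: "D x \<ge> qform S x + c * (x \<bullet> x)" for x
    using c(2)[of x] by (simp add: D_def S qform_drift[of A Q x N])
  \<comment> \<open>From \<open>S \<le> K |x|\<^sup>2\<close> and \<open>S + c |x|\<^sup>2 \<le> D\<close> it follows that \<open>(K + c) S \<le> K D\<close>.\<close>
  define \<theta> where "\<theta> = K / (K + c)"
  have \<theta>: "0 \<le> \<theta>" "\<theta> < 1" using K(1) c(1) by (simp_all add: \<theta>_def)
  have S_le: "qform S x \<le> \<theta> * D x" for x
  proof -
    have "c * qform S x \<le> c * (K * (x \<bullet> x))"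
      using c(1) K(2) by (intro mult_left_mono) auto
    moreover have "K * (qform S x + c * (x \<bullet> x)) \<le> K * D x"
      using D K(1) by (intro mult_left_mono) auto
    ultimately have "(K + c) * qform S x \<le> K * D x" by (simp add: algebra_simps)
    then show ?thesis using K(1) c(1) by (simp add: \<theta>_def field_simps)
  qed
  have D_nonneg: "0 \<le> D x" for x
  proof -
    have "0 \<le> c * (x \<bullet> x)" using c(1) by simp
    with D[of x] S_nonneg[of x] show ?thesis by linarith
  qed
  have "(\<integral>\<^sup>+s. ennreal (\<Sum>k\<in>UNIV. qform Q (flow A x s v* N $ k)) \<partial>half_line) \<le> ennreal (\<theta> * qform Q x)" for x
  proof -
    have "(\<integral>\<^sup>+s. ennreal (\<Sum>k\<in>UNIV. qform Q (flow A x s v* N $ k)) \<partial>half_line)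
        \<le> (\<integral>\<^sup>+s. ennreal \<theta> * ennreal (D (flow A x s)) \<partial>half_line)"
      using S_le \<theta>(1) by (intro nn_integral_mono) (simp add: S[symmetric] ennreal_mult'[symmetric] ennreal_leI)
    also have "\<dots> = ennreal \<theta> * (\<integral>\<^sup>+s. ennreal (D (flow A x s)) \<partial>half_line)"
    proof (rule nn_integral_cmult)
      have "D \<in> borel_measurable borel"
        unfolding D_def by (intro borel_measurable_continuous_onI continuous_intros continuous_on_qform)
      then show "(\<lambda>s. ennreal (D (flow A x s))) \<in> borel_measurable half_line" by measurable
    qed
    also have "(\<integral>\<^sup>+s. ennreal (D (flow A x s)) \<partial>half_line) = ennreal (qform Q x)"
      unfolding D_def
      by (rule nn_integral_flow[OF cert Q]) (use D_nonneg in \<open>simp add: D_def\<close>)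
    finally show ?thesis using \<theta>(1) by (simp add: ennreal_mult')
  qed
  with \<theta> show ?thesis by (rule that)
qed

lemma measurable_qform [measurable]: "qform P \<in> borel_measurable borel"
  by (intro borel_measurable_continuous_onI continuous_on_qform)

text \<open>The form of \<open>P\<close> is a fixed point of the monotone map that generates the partial sums, so these stay
  below it. The gap is at most \<open>\<kappa> Q\<close> initially, and every step multiplies this bound by \<open>\<theta>\<close>.\<close>

theorem kernel_energy_sums:
  fixes A :: "real ^ 'n ^ 'n"
  assumes cert: "lyap_certificate A N Q" and P: "lyap A N P + B ** transpose B = 0"
  shows "(\<Sum>i. kernel_energy A B N (Suc i) x) = ennreal (qform P x)"
proof (rule antisym)
  have Q: "psd Q" using cert by (simp add: lyap_certificate_def)
  have psd: "psd P" by (rule lyap_solution_psd[OF cert P])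
  have fixpoint: "ennreal (qform P x) = (\<integral>\<^sup>+s. ennreal ((flow A x s v* B) \<bullet> (flow A x s v* B))
        + (\<Sum>k\<in>UNIV. ennreal (qform P (flow A x s v* N $ k))) \<partial>half_line)" for x
  proof -
    have "ennreal (qform P x) = (\<integral>\<^sup>+s. ennreal (- qform (A ** P + P ** transpose A) (flow A x s)) \<partial>half_line)"
    proof (rule nn_integral_flow[OF cert psd, symmetric])
      show "qform (A ** P + P ** transpose A) y \<le> 0" for y
        using drift_of_solution[OF P, of y] sum_nonneg[of UNIV "\<lambda>k. qform P (y v* N $ k)"]
          inner_ge_zero[of "y v* B"] psd_nonneg[OF psd] by (smt (verit))
    qed
    then show ?thesis
      by (simp add: drift_of_solution[OF P] sum_ennreal psd_nonneg[OF psd] sum_nonneg)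
  qed
  have upper: "(\<Sum>i<n. kernel_energy A B N (Suc i) x) \<le> ennreal (qform P x)" for n x
  proof (induction n arbitrary: x)
    case (Suc n)
    show ?case
      unfolding kernel_energy_partial_sum fixpoint[of x]
      by (intro nn_integral_mono add_mono order_refl sum_mono Suc)
  qed simp
  then show "(\<Sum>i. kernel_energy A B N (Suc i) x) \<le> ennreal (qform P x)"
    by (intro suminf_le_const) auto
  obtain \<kappa> where \<kappa>: "\<kappa> \<ge> 0" "\<And>x. qform P x \<le> \<kappa> * qform Q x"
    using lyap_certificate_dominates[OF cert psd_transpose[OF psd]] by blast
  obtain \<theta> where \<theta>: "0 \<le> \<theta>" "\<theta> < 1"
    and contr: "\<And>x. (\<integral>\<^sup>+s. ennreal (\<Sum>k\<in>UNIV. qform Q (flow A x s v* N $ k)) \<partial>half_line) \<le> ennreal (\<theta> * qform Q x)"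
    using certificate_contraction[OF cert] by metis
  have lower: "ennreal (qform P x) \<le> (\<Sum>i<n. kernel_energy A B N (Suc i) x) + ennreal (\<kappa> * \<theta> ^ n * qform Q x)" for n x
  proof (induction n arbitrary: x)
    case 0
    show ?case using \<kappa>(2)[of x] by (simp add: ennreal_leI)
  next
    case (Suc n)
    let ?b = "\<lambda>s. ennreal ((flow A x s v* B) \<bullet> (flow A x s v* B))"
    let ?e = "\<lambda>s k. \<Sum>i<n. kernel_energy A B N (Suc i) (flow A x s v* N $ k)"
    let ?q = "\<lambda>s. ennreal (\<Sum>k\<in>UNIV. qform Q (flow A x s v* N $ k))"
    have "ennreal (qform P x) \<le> (\<integral>\<^sup>+s. ?b s + (\<Sum>k\<in>UNIV. ?e s k
        + ennreal (\<kappa> * \<theta> ^ n * qform Q (flow A x s v* N $ k))) \<partial>half_line)"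
      unfolding fixpoint[of x] by (intro nn_integral_mono add_mono order_refl sum_mono Suc)
    also have "\<dots> = (\<integral>\<^sup>+s. (?b s + (\<Sum>k\<in>UNIV. ?e s k)) + ennreal (\<kappa> * \<theta> ^ n) * ?q s \<partial>half_line)"
    proof -
      have "(\<Sum>k\<in>UNIV. ennreal (\<kappa> * \<theta> ^ n * qform Q (y v* N $ k)))
          = ennreal (\<kappa> * \<theta> ^ n) * ennreal (\<Sum>k\<in>UNIV. qform Q (y v* N $ k))" for y
        using \<kappa>(1) \<theta>(1) psd_nonneg[OF Q]
        by (simp add: ennreal_mult[symmetric] sum_nonneg sum_ennreal sum_distrib_left)
      then show ?thesis by (simp add: sum.distrib add.assoc)
    qed
    also have "\<dots> = (\<Sum>i<Suc n. kernel_energy A B N (Suc i) x)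
        + ennreal (\<kappa> * \<theta> ^ n) * (\<integral>\<^sup>+s. ?q s \<partial>half_line)"
      unfolding kernel_energy_partial_sum by (subst nn_integral_add) (auto simp: nn_integral_cmult)
    also have "\<dots> \<le> (\<Sum>i<Suc n. kernel_energy A B N (Suc i) x)
        + ennreal (\<kappa> * \<theta> ^ n) * ennreal (\<theta> * qform Q x)"
      by (intro add_mono order_refl mult_left_mono contr) simp
    also have "ennreal (\<kappa> * \<theta> ^ n) * ennreal (\<theta> * qform Q x) = ennreal (\<kappa> * \<theta> ^ Suc n * qform Q x)"
      using \<kappa>(1) \<theta>(1) psd_nonneg[OF Q] by (simp add: ennreal_mult[symmetric] mult_ac)
    finally show ?case .
  qed
  show "ennreal (qform P x) \<le> (\<Sum>i. kernel_energy A B N (Suc i) x)"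
  proof (rule ennreal_le_epsilon)
    fix e :: real assume "e > 0"
    have "(\<lambda>n. \<kappa> * \<theta> ^ n * qform Q x) \<longlonglongrightarrow> \<kappa> * 0 * qform Q x"
      using \<theta> by (intro tendsto_mult tendsto_const LIMSEQ_realpow_zero)
    then have "\<forall>\<^sub>F n in sequentially. \<kappa> * \<theta> ^ n * qform Q x < e"
      using \<open>e > 0\<close> by (intro order_tendstoD(2)) simp_all
    then obtain n where n: "\<kappa> * \<theta> ^ n * qform Q x < e"
      by (auto simp: eventually_sequentially)
    have "ennreal (qform P x) \<le> (\<Sum>i<n. kernel_energy A B N (Suc i) x) + ennreal (\<kappa> * \<theta> ^ n * qform Q x)"
      by (rule lower)
    also have "\<dots> \<le> (\<Sum>i. kernel_energy A B N (Suc i) x) + ennreal e"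
      using n by (intro add_mono sum_le_suminf ennreal_leI) auto
    finally show "ennreal (qform P x) \<le> (\<Sum>i. kernel_energy A B N (Suc i) x) + ennreal e" .
  qed
qed

section \<open>The squared H2 norm in terms of the Gramian\<close>

text \<open>Splitting the Gramian into rank one terms reduces the energy of a quadratic output to energies of
  finitely many linear outputs.\<close>

lemma psd_gram_sum:
  fixes P :: "real ^ 'n ^ 'n"
  assumes "psd P"
  obtains n :: nat and g :: "nat \<Rightarrow> real ^ 'n" where
    "\<And>x. qform P x = (\<Sum>l<n. (g l \<bullet> x)\<^sup>2)" "\<And>R. R \<bullet> P = (\<Sum>l<n. qform R (g l))"
proof -
  obtain gs :: "(real ^ 'n) list" where gs: "\<And>x. qform P x = (\<Sum>g\<leftarrow>gs. (g \<bullet> x)\<^sup>2)"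
    using psd_gram_decomposition[OF assms] by blast
  define n g where "n = length gs" and "g = nth gs"
  have q: "qform P x = (\<Sum>l<n. (g l \<bullet> x)\<^sup>2)" for x
    by (simp add: gs n_def g_def sum_list_sum_nth atLeast0LessThan)
  define P' where "P' = (\<Sum>l<n. \<chi> a b. g l $ a * g l $ b)"
  have rank1: "qform (\<chi> a b. v $ a * v $ b) x = (v \<bullet> x)\<^sup>2" for v x :: "real ^ 'n"
    by (simp add: qform_def matrix_vector_mult_def inner_vec_def power2_eq_square sum_product
        sum_distrib_left mult_ac)
  have inner1: "R \<bullet> (\<chi> a b. v $ a * v $ b) = qform R v" for R :: "real ^ 'n ^ 'n" and v
    by (simp add: qform_def matrix_vector_mult_def inner_vec_def sum_distrib_left mult_ac)
  have "P - P' = 0"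
  proof (rule matrix_eq_0_if_qform_eq_0)
    have "transpose (\<chi> a b. v $ a * v $ b) = (\<chi> a b. v $ a * v $ b)" for v :: "real ^ 'n"
      by (simp add: transpose_def vec_eq_iff mult.commute)
    then show "transpose (P - P') = P - P'"
      using psd_transpose[OF assms] by (simp add: P'_def transpose_linear_simps)
    show "qform (P - P') x = 0" for x
      by (simp add: qform_diff P'_def qform_sum rank1 q)
  qed
  then have "R \<bullet> P = (\<Sum>l<n. qform R (g l))" for R
    by (simp add: P'_def inner_sum_right inner1)
  with q show ?thesis by (rule that)
qed

lemma frob_norm_sq: "(frob_norm cols H)\<^sup>2 = (\<Sum>i\<in>UNIV. \<Sum>j\<in>cols. (H i j)\<^sup>2)"
  by (simp add: frob_norm_def sum_nonneg)

lemma frob_norm_h_C: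
  "(frob_norm (words i) (h_C (A, B, C, N, M) i t))\<^sup>2 = (\<Sum>p\<in>UNIV. kernel_power A B N i (C $ p) t)"
  by (simp add: frob_norm_sq h_C_def kernel_power_def fmul_def entries_def kernel_col_def inner_vec_def)

lemma frob_norm_h_M:
  "(frob_norm (words i \<times> words j) (h_M (A, B, C, N, M) i j t s))\<^sup>2
    = (\<Sum>p\<in>UNIV. \<Sum>v\<in>words i. kernel_power A B N j (M $ p *v kernel_col A B N i t v) s)"
proof -
  have "h_M (A, B, C, N, M) i j t s p (v, w)
      = (M $ p *v kernel_col A B N i t v) \<bullet> kernel_col A B N j s w" for p v w
  proof -
    have "h_M (A, B, C, N, M) i j t s p (v, w)
        = (\<Sum>cr\<in>UNIV \<times> UNIV. M $ p $ snd cr $ fst cr * (Pbar A B N i t (fst cr) v * Pbar A B N j s (snd cr) w))"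
      by (simp add: h_M_def fmul_def entries_def vecs_transposed_def kron_def split_def)
    also have "\<dots> = (\<Sum>c\<in>UNIV. \<Sum>r\<in>UNIV. M $ p $ r $ c * (Pbar A B N i t c v * Pbar A B N j s r w))"
      by (simp only: sum.cartesian_product split_def)
    also have "\<dots> = (\<Sum>r\<in>UNIV. \<Sum>c\<in>UNIV. M $ p $ r $ c * (Pbar A B N i t c v * Pbar A B N j s r w))"
      by (rule sum.swap)
    also have "\<dots> = (M $ p *v kernel_col A B N i t v) \<bullet> kernel_col A B N j s w"
      by (simp add: kernel_col_def inner_vec_def matrix_vector_mult_def sum_distrib_left mult_ac)
    finally show ?thesis .
  qed
  then show ?thesis
    unfolding frob_norm_sq kernel_power_def
    by (intro sum.cong refl) (simp add: sum.cartesian_product')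
qed

text \<open>\<open>tr (C P C\<^sup>T) + \<Sum> tr (M\<^sub>p P M\<^sub>p P)\<close> for symmetric \<open>M\<^sub>p\<close> and \<open>P\<close>, in terms of the inner product of
  matrices.\<close>

definition gramian_cost :: "real ^ 'n ^ 'p \<Rightarrow> real ^ 'n ^ 'n ^ 'p \<Rightarrow> real ^ 'n ^ 'n \<Rightarrow> real" where
  "gramian_cost C M P = C \<bullet> (C ** P) + (\<Sum>p\<in>UNIV. M $ p \<bullet> (P ** M $ p ** P))"

lemma h_C_energy:
  "(\<integral>\<^sup>+t. ennreal ((frob_norm (words i) (h_C (A, B, C, N, M) i t))\<^sup>2) \<partial>time_measure i)
    = (\<Sum>p\<in>UNIV. kernel_energy A B N i (C $ p))"
proof -
  note measurable_kernel_power[measurable]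
  have "(\<lambda>t. ennreal (kernel_power A B N i x t)) \<in> borel_measurable (time_measure i)" for x
    by measurable
  then show ?thesis
    by (simp add: frob_norm_h_C kernel_power_nonneg kernel_energy_def nn_integral_sum flip: sum_ennreal)
qed

lemma h_M_energy:
  "(\<integral>\<^sup>+s. ennreal ((frob_norm (words i \<times> words j) (h_M (A, B, C, N, M) i j t s))\<^sup>2) \<partial>time_measure j)
    = (\<Sum>p\<in>UNIV. \<Sum>v\<in>words i. kernel_energy A B N j (M $ p *v kernel_col A B N i t v))"
proof -
  note measurable_kernel_power[measurable]
  have "(\<lambda>t. ennreal (kernel_power A B N j x t)) \<in> borel_measurable (time_measure j)" for x
    by measurable
  then show ?thesis
    by (simp add: frob_norm_h_M kernel_power_nonneg kernel_energy_def nn_integral_sum sum_nonneg flip: sum_ennreal)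
qed

lemma inner_congruence_symmetric:
  assumes "transpose M = M" "transpose P = P"
  shows "M \<bullet> (P ** M ** P) = (M ** P ** M) \<bullet> (P :: real ^ 'n ^ 'n)"
proof -
  have "M \<bullet> (P ** M ** P) = (P ** M) \<bullet> (M ** P)"
    using inner_matrix_mult_left[of M P "M ** P"] assms by (simp add: matrix_mul_assoc)
  also have "\<dots> = (M ** P) \<bullet> (P ** M)"
    by (rule inner_commute)
  also have "\<dots> = (M ** P ** M) \<bullet> P"
    using inner_matrix_mult_right[of "M ** P" P M] assms by simp
  finally show ?thesis .
qed

text \<open>In the quadratic part, the inner integrals and the inner series turn the second kernel into the
  form of \<open>P\<close>, evaluated at \<open>M\<^sub>p\<close> times the columns of the first kernel. Writing that form as a sum of
  squares \<open>(g\<^sub>l \<bullet> x)\<^sup>2\<close> leaves the energies of the first kernel at the vectors \<open>g\<^sub>l v* M\<^sub>p\<close>.\<close>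

theorem H2_norm_sq_eq_gramian_cost:
  fixes A :: "real ^ 'n ^ 'n" and M :: "real ^ 'n ^ 'n ^ 'p"
  assumes cert: "lyap_certificate A N Q" and P: "lyap A N P + B ** transpose B = 0"
    and M: "\<And>p. transpose (M $ p) = M $ p"
  shows "H2_norm_sq (A, B, C, N, M) = ennreal (gramian_cost C M P)" and "0 \<le> gramian_cost C M P"
proof -
  have psd: "psd P" by (rule lyap_solution_psd[OF cert P])
  note sums = kernel_energy_sums[OF cert P]
  obtain n :: nat and g where q: "\<And>x. qform P x = (\<Sum>l<n. (g l \<bullet> x)\<^sup>2)"
    and gR: "\<And>R. R \<bullet> P = (\<Sum>l<n. qform R (g l))"
    using psd_gram_sum[OF psd] by metis
  have eqC: "(\<Sum>p\<in>UNIV. qform P (C $ p)) = C \<bullet> (C ** P)"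
  proof -
    have "(C ** P) $ p = C $ p v* P" for p
      by (simp add: vec_eq_iff matrix_matrix_mult_def vector_matrix_mult_def mult.commute)
    then show ?thesis
      by (simp add: inner_vec_def[of C] qform_def inner_matrix_vector inner_commute)
  qed
  have eqM: "(\<Sum>p\<in>UNIV. \<Sum>l<n. qform P (g l v* M $ p)) = (\<Sum>p\<in>UNIV. M $ p \<bullet> (P ** M $ p ** P))"
  proof (rule sum.cong[OF refl])
    fix p
    have "(\<Sum>l<n. qform P (g l v* M $ p)) = (M $ p ** P ** M $ p) \<bullet> P"
      using qform_congruence[of "M $ p" P] by (simp add: gR M)
    also have "\<dots> = M $ p \<bullet> (P ** M $ p ** P)"
      by (rule inner_congruence_symmetric[OF M psd_transpose[OF psd], symmetric])
    finally show "(\<Sum>l<n. qform P (g l v* M $ p)) = M $ p \<bullet> (P ** M $ p ** P)" .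
  qed
  have "(\<Sum>i. \<integral>\<^sup>+t. ennreal ((frob_norm (words (Suc i)) (h_C (A, B, C, N, M) (Suc i) t))\<^sup>2) \<partial>time_measure (Suc i))
      = (\<Sum>p\<in>UNIV. ennreal (qform P (C $ p)))"
    by (simp add: h_C_energy suminf_sum sums)
  also have "\<dots> = ennreal (\<Sum>p\<in>UNIV. qform P (C $ p))"
    by (simp add: sum_ennreal psd_nonneg[OF psd])
  also note eqC
  finally have 1: "(\<Sum>i. \<integral>\<^sup>+t. ennreal ((frob_norm (words (Suc i)) (h_C (A, B, C, N, M) (Suc i) t))\<^sup>2)
      \<partial>time_measure (Suc i)) = ennreal (C \<bullet> (C ** P))" .
  have "(\<Sum>i. \<Sum>j. \<integral>\<^sup>+t. \<integral>\<^sup>+s.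
         ennreal ((frob_norm (words (Suc i) \<times> words (Suc j)) (h_M (A, B, C, N, M) (Suc i) (Suc j) t s))\<^sup>2)
         \<partial>time_measure (Suc j) \<partial>time_measure (Suc i))
      = (\<Sum>i. \<integral>\<^sup>+t. (\<Sum>j. \<Sum>p\<in>UNIV. \<Sum>v\<in>words (Suc i).
          kernel_energy A B N (Suc j) (M $ p *v kernel_col A B N (Suc i) t v)) \<partial>time_measure (Suc i))"
    unfolding h_M_energy by (subst nn_integral_suminf) simp_all
  also have "\<dots> = (\<Sum>i. \<integral>\<^sup>+t. (\<Sum>p\<in>UNIV. \<Sum>v\<in>words (Suc i).
          ennreal (qform P (M $ p *v kernel_col A B N (Suc i) t v))) \<partial>time_measure (Suc i))"
    by (simp add: suminf_sum sums)
  also have "\<dots> = (\<Sum>i. \<integral>\<^sup>+t. (\<Sum>p\<in>UNIV. \<Sum>l<n. ennreal (kernel_power A B N (Suc i) (g l v* M $ p) t))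
        \<partial>time_measure (Suc i))"
  proof -
    have "(\<Sum>v\<in>words (Suc i). ennreal (qform P (M $ p *v kernel_col A B N (Suc i) t v)))
        = (\<Sum>l<n. ennreal (kernel_power A B N (Suc i) (g l v* M $ p) t))" for i t p
    proof -
      have "(\<Sum>v\<in>words (Suc i). qform P (M $ p *v kernel_col A B N (Suc i) t v))
          = (\<Sum>l<n. kernel_power A B N (Suc i) (g l v* M $ p) t)"
        unfolding kernel_power_def q inner_matrix_vector by (rule sum.swap)
      then show ?thesis
        by (simp add: sum_ennreal psd_nonneg[OF psd] kernel_power_nonneg)
    qed
    then show ?thesis by simp
  qed
  also have "\<dots> = (\<Sum>i. \<Sum>p\<in>UNIV. \<Sum>l<n. kernel_energy A B N (Suc i) (g l v* M $ p))"
  proof -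
    note measurable_kernel_power[measurable]
    have "(\<lambda>t. ennreal (kernel_power A B N (Suc i) x t)) \<in> borel_measurable (time_measure (Suc i))" for i x
      by measurable
    then show ?thesis by (simp add: nn_integral_sum kernel_energy_def)
  qed
  also have "\<dots> = (\<Sum>p\<in>UNIV. \<Sum>l<n. ennreal (qform P (g l v* M $ p)))"
    by (simp add: suminf_sum sums)
  also have "\<dots> = ennreal (\<Sum>p\<in>UNIV. \<Sum>l<n. qform P (g l v* M $ p))"
    by (simp add: sum_ennreal psd_nonneg[OF psd] sum_nonneg)
  also note eqM
  finally have 2: "(\<Sum>i. \<Sum>j. \<integral>\<^sup>+t. \<integral>\<^sup>+s.
         ennreal ((frob_norm (words (Suc i) \<times> words (Suc j)) (h_M (A, B, C, N, M) (Suc i) (Suc j) t s))\<^sup>2)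
         \<partial>time_measure (Suc j) \<partial>time_measure (Suc i)) = ennreal (\<Sum>p\<in>UNIV. M $ p \<bullet> (P ** M $ p ** P))" .
  have nonneg: "0 \<le> C \<bullet> (C ** P)" "0 \<le> (\<Sum>p\<in>UNIV. M $ p \<bullet> (P ** M $ p ** P))"
    unfolding eqC[symmetric] eqM[symmetric] by (simp_all add: sum_nonneg psd_nonneg[OF psd])
  then show "0 \<le> gramian_cost C M P" by (simp add: gramian_cost_def)
  show "H2_norm_sq (A, B, C, N, M) = ennreal (gramian_cost C M P)"
    unfolding H2_norm_sq_def 1 2 gramian_cost_def using nonneg by (simp add: ennreal_plus)
qed

section \<open>The first variation of the cost\<close>

text \<open>The increment of \<open>Y\<close> is \<open>e\<close> times an affine function of \<open>Y\<close>. For small \<open>e\<close> this can be absorbed, so \<open>Y\<close>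
  is bounded near \<open>0\<close>; hence it is continuous at \<open>0\<close>, and hence the difference quotient converges.\<close>

lemma implicit_affine_derivative:
  fixes Y :: "real \<Rightarrow> 'a::real_normed_vector"
  assumes F1: "bounded_linear F1" and F2: "bounded_linear F2"
    and eq: "\<forall>\<^sub>F e in at 0. Y e - Y 0 = e *\<^sub>R (F1 (Y e) + c1 + e *\<^sub>R (F2 (Y e) + c2))"
  shows "(Y has_vector_derivative F1 (Y 0) + c1) (at 0)"
proof -
  define G where "G e = F1 (Y e) + c1 + e *\<^sub>R (F2 (Y e) + c2)" for e
  obtain k1 where k1: "k1 > 0" "\<And>y. norm (F1 y) \<le> norm y * k1"
    using bounded_linear.pos_bounded[OF F1] by blast
  obtain k2 where k2: "k2 > 0" "\<And>y. norm (F2 y) \<le> norm y * k2"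
    using bounded_linear.pos_bounded[OF F2] by blast
  define b where "b = k1 + k2"
  define a where "a = norm c1 + norm c2"
  have b: "b > 0" using k1 k2 by (simp add: b_def)
  have small: "\<forall>\<^sub>F e in at (0 :: real). \<bar>e\<bar> < min 1 (1 / (2 * b))"
    using b unfolding eventually_at dist_real_def by (intro exI[of _ "min 1 (1 / (2 * b))"]) auto
  have bound: "\<forall>\<^sub>F e in at 0. norm (Y e) \<le> 2 * norm (Y 0) + a / b"
    using eq small
  proof eventually_elim
    fix e assume e: "Y e - Y 0 = e *\<^sub>R (F1 (Y e) + c1 + e *\<^sub>R (F2 (Y e) + c2))"
      and small: "\<bar>e\<bar> < min 1 (1 / (2 * b))"
    have "norm (F1 (Y e) + c1 + e *\<^sub>R (F2 (Y e) + c2))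
        \<le> (norm (F1 (Y e)) + norm c1) + \<bar>e\<bar> * (norm (F2 (Y e)) + norm c2)"
      by (intro order_trans[OF norm_triangle_ineq] add_mono norm_triangle_ineq)
         (simp add: mult_left_mono norm_triangle_ineq)
    also have "\<bar>e\<bar> * (norm (F2 (Y e)) + norm c2) \<le> 1 * (norm (F2 (Y e)) + norm c2)"
      using small by (intro mult_right_mono) auto
    finally have "norm (F1 (Y e) + c1 + e *\<^sub>R (F2 (Y e) + c2)) \<le> norm (Y e) * b + a"
      using k1(2)[of "Y e"] k2(2)[of "Y e"] by (simp add: a_def b_def algebra_simps)
    then have "norm (Y e - Y 0) \<le> 1 / (2 * b) * (norm (Y e) * b + a)"
      unfolding e using small b by (simp only: norm_scaleR) (intro mult_mono, auto)
    also have "\<dots> = norm (Y e) / 2 + a / (2 * b)"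
      using b by (simp add: field_simps)
    finally show "norm (Y e) \<le> 2 * norm (Y 0) + a / b"
      using norm_triangle_sub[of "Y e" "Y 0"] by (simp add: field_simps)
  qed
  then have Bf: "Bfun Y (at 0)" by (rule BfunI)
  have zero: "((\<lambda>e. e *\<^sub>R F (Y e)) \<longlongrightarrow> 0) (at 0)" if "bounded_linear F" for F :: "'a \<Rightarrow> 'a"
  proof -
    have "((\<lambda>e. e *\<^sub>R Y e) \<longlongrightarrow> 0) (at 0)"
      using bounded_bilinear.Zfun_prod_Bfun[OF bounded_bilinear_scaleR, of "\<lambda>e. e" "at 0" Y] Bf
        tendsto_ident_at[of "0 :: real" UNIV]
      by (simp add: tendsto_Zfun_iff)
    from bounded_linear.tendsto[OF that this] show ?thesis
      by (simp add: linear_scale[OF bounded_linear.linear[OF that]] linear_0[OF bounded_linear.linear[OF that]])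
  qed
  have e0: "((\<lambda>e. e *\<^sub>R c) \<longlongrightarrow> 0) (at (0 :: real))" for c :: 'a
    using tendsto_scaleR[OF tendsto_ident_at[of "0 :: real" UNIV] tendsto_const[of c]] by simp
  have eG: "((\<lambda>e. e *\<^sub>R G e) \<longlongrightarrow> 0) (at 0)"
  proof -
    have "((\<lambda>e. e *\<^sub>R F1 (Y e) + e *\<^sub>R c1 + e *\<^sub>R (e *\<^sub>R F2 (Y e) + e *\<^sub>R c2)) \<longlongrightarrow> 0 + 0 + 0 *\<^sub>R (0 + 0)) (at 0)"
      by (intro tendsto_add tendsto_scaleR tendsto_ident_at zero F1 F2 e0)
    then show ?thesis by (simp add: G_def scaleR_add_right)
  qed
  have "((\<lambda>e. Y 0 + e *\<^sub>R G e) \<longlongrightarrow> Y 0 + 0) (at 0)"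
    by (intro tendsto_add tendsto_const eG)
  moreover have "\<forall>\<^sub>F e in at 0. Y e = Y 0 + e *\<^sub>R G e"
    using eq by eventually_elim (simp add: G_def algebra_simps)
  ultimately have Y: "(Y \<longlongrightarrow> Y 0) (at 0)"
    by (simp add: tendsto_cong)
  have "((\<lambda>e. F1 (Y e) + c1 + (e *\<^sub>R F2 (Y e) + e *\<^sub>R c2)) \<longlongrightarrow> F1 (Y 0) + c1 + (0 + 0)) (at 0)"
    by (intro tendsto_add tendsto_const bounded_linear.tendsto[OF F1 Y] zero F2 e0)
  then have "(G \<longlongrightarrow> F1 (Y 0) + c1) (at 0)"
    by (simp add: G_def[abs_def] scaleR_add_right)
  then have "((\<lambda>e. norm (G e - (F1 (Y 0) + c1))) \<longlongrightarrow> 0) (at 0)"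
    using LIM_zero_iff tendsto_norm_zero by blast
  moreover have "\<forall>\<^sub>F e in at 0. norm (Y (0 + e) - Y 0 - e *\<^sub>R (F1 (Y 0) + c1)) / norm e
      = norm (G e - (F1 (Y 0) + c1))"
    using eq eventually_neq_at_within[of 0]
  proof eventually_elim
    fix e :: real
    assume "Y e - Y 0 = e *\<^sub>R (F1 (Y e) + c1 + e *\<^sub>R (F2 (Y e) + c2))" and "e \<noteq> 0"
    then have "Y (0 + e) - Y 0 - e *\<^sub>R (F1 (Y 0) + c1) = e *\<^sub>R (G e - (F1 (Y 0) + c1))"
      by (simp add: G_def scaleR_diff_right scaleR_add_right)
    then show "norm (Y (0 + e) - Y 0 - e *\<^sub>R (F1 (Y 0) + c1)) / norm e = norm (G e - (F1 (Y 0) + c1))"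
      using \<open>e \<noteq> 0\<close> by simp
  qed
  ultimately have "((\<lambda>e. norm (Y (0 + e) - Y 0 - e *\<^sub>R (F1 (Y 0) + c1)) / norm e) \<longlongrightarrow> 0) (at 0)"
    by (simp add: tendsto_cong)
  then show ?thesis
    unfolding has_vector_derivative_def has_derivative_at by (simp add: bounded_linear_scaleR_left)
qed

text \<open>Half of the derivative of \<open>lyap\<close> in the direction \<open>(A', N')\<close>: at a symmetric \<open>Y\<close> the other half is its
  transpose.\<close>

definition lyap_variation :: "real ^ 'n ^ 'n \<Rightarrow> real ^ 'n ^ 'n ^ 'm \<Rightarrow> real ^ 'n ^ 'n ^ 'm
    \<Rightarrow> real ^ 'n ^ 'n \<Rightarrow> real ^ 'n ^ 'n" where
  "lyap_variation A' N N' Y = A' ** Y + (\<Sum>k\<in>UNIV. N' $ k ** Y ** transpose (N $ k))"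

lemma lyap_perturbed:
  assumes "transpose Y = Y"
  shows "lyap (A + e *\<^sub>R A') (N + e *\<^sub>R N') Y
    = lyap A N Y + e *\<^sub>R (lyap_variation A' N N' Y + transpose (lyap_variation A' N N' Y)
        + e *\<^sub>R (\<Sum>k\<in>UNIV. N' $ k ** Y ** transpose (N' $ k)))"
  using assms
  by (simp add: sylvester_def lyap_variation_def matrix_mult.add_left matrix_mult.add_right
      matrix_mult.scaleR_left matrix_mult.scaleR_right transpose_linear_simps transpose_scalar
      matrix_transpose_mul matrix_mul_assoc sum.distrib scaleR_right.sum scaleR_add_right)

lemma linear_lyap_variation: "linear (lyap_variation A' N N')"
  unfolding lyap_variation_def
  by (rule linearI)
     (simp_all add: matrix_mult.add_left matrix_mult.add_right matrix_mult.scaleR_left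
       matrix_mult.scaleR_right sum.distrib scaleR_right.sum scaleR_add_right)

text \<open>Applying the inverse of \<open>lyap A N\<close> to the difference of the two Lyapunov equations expresses the
  increment of the Gramian as \<open>e\<close> times an affine function of itself.\<close>

lemma gramian_derivative:
  fixes A :: "real ^ 'n ^ 'n"
  assumes cert: "lyap_certificate A N Q"
    and P0: "lyap A N (P 0) + B ** transpose B = 0"
    and P: "\<forall>\<^sub>F e in at 0. transpose (P e) = P e \<and>
      lyap (A + e *\<^sub>R A') (N + e *\<^sub>R N') (P e) + (B + e *\<^sub>R B') ** transpose (B + e *\<^sub>R B') = 0"
  defines "Z \<equiv> lyap_variation A' N N' (P 0) + B' ** transpose B"
  obtains D where "(P has_vector_derivative D) (at 0)" "lyap A N D = - (Z + transpose Z)"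
proof -
  let ?V = "lyap_variation A' N N'"
  let ?W = "\<lambda>Y. \<Sum>k\<in>UNIV. N' $ k ** Y ** transpose (N' $ k)"
  let ?B1 = "B' ** transpose B + B ** transpose B'"
  let ?B2 = "B' ** transpose B'"
  have inj: "inj (lyap A N)"
    using sylvester_inject[OF cert cert] by (auto intro: injI)
  obtain I where I: "linear I" and left: "\<And>Y. I (lyap A N Y) = Y"
    using linear_injective_left_inverse[OF linear_sylvester inj] by (auto simp: o_def fun_eq_iff)
  have right: "lyap A N (I Y) = Y" for Y
    using lyap_surj[OF cert, of Y] left by metis
  define F1 where "F1 Y = - I (?V Y + transpose (?V Y))" for Y
  define F2 where "F2 Y = - I (?W Y)" for Y
  have VT: "linear (\<lambda>Y. ?V Y + transpose (?V Y))"
    using linear_lyap_variation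
    by (intro linear_compose_add linear_compose[of ?V transpose, unfolded o_def])
       (simp_all add: linear_conv_bounded_linear bounded_linear_transpose)
  have F1: "bounded_linear F1"
    unfolding F1_def linear_conv_bounded_linear[symmetric]
    by (intro linear_compose_neg linear_compose[OF VT I, unfolded o_def])
  have W: "linear ?W"
    by (rule linearI)
       (simp_all add: matrix_mult.add_left matrix_mult.add_right matrix_mult.scaleR_left
         matrix_mult.scaleR_right sum.distrib scaleR_right.sum)
  have F2: "bounded_linear F2"
    unfolding F2_def linear_conv_bounded_linear[symmetric]
    by (intro linear_compose_neg linear_compose[OF W I, unfolded o_def])
  have "\<forall>\<^sub>F e in at 0. P e - P 0 = e *\<^sub>R (F1 (P e) + (- I ?B1) + e *\<^sub>R (F2 (P e) + (- I ?B2)))"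
    using P
  proof eventually_elim
    fix e
    assume e: "transpose (P e) = P e \<and>
      lyap (A + e *\<^sub>R A') (N + e *\<^sub>R N') (P e) + (B + e *\<^sub>R B') ** transpose (B + e *\<^sub>R B') = 0"
    have "(B + e *\<^sub>R B') ** transpose (B + e *\<^sub>R B') = B ** transpose B + e *\<^sub>R (?B1 + e *\<^sub>R ?B2)"
      by (simp add: transpose_linear_simps transpose_scalar matrix_mult.add_left matrix_mult.add_right
          matrix_mult.scaleR_left matrix_mult.scaleR_right scaleR_add_right)
    moreover have "lyap (A + e *\<^sub>R A') (N + e *\<^sub>R N') (P e)
        = lyap A N (P e) + e *\<^sub>R (?V (P e) + transpose (?V (P e)) + e *\<^sub>R ?W (P e))"
      using e by (intro lyap_perturbed) simp
    ultimately have "lyap A N (P e) + e *\<^sub>R (?V (P e) + transpose (?V (P e)) + e *\<^sub>R ?W (P e))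
        + (B ** transpose B + e *\<^sub>R (?B1 + e *\<^sub>R ?B2)) = 0"
      using e by simp
    then have "lyap A N (P e) + B ** transpose B
        + e *\<^sub>R (?V (P e) + transpose (?V (P e)) + ?B1 + e *\<^sub>R (?W (P e) + ?B2)) = 0"
      by (simp only: scaleR_add_right add_ac)
    then have "lyap A N (P e) + B ** transpose B
        = - (e *\<^sub>R (?V (P e) + transpose (?V (P e)) + ?B1 + e *\<^sub>R (?W (P e) + ?B2)))"
      by (simp only: eq_neg_iff_add_eq_0)
    moreover have "lyap A N (P e - P 0) = lyap A N (P e) + B ** transpose B"
      using P0 by (simp add: linear_diff[OF linear_sylvester] eq_neg_iff_add_eq_0 diff_eq_eq algebra_simps)
    ultimately have "lyap A N (P e - P 0)
        = - (e *\<^sub>R (?V (P e) + transpose (?V (P e)) + ?B1 + e *\<^sub>R (?W (P e) + ?B2)))"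
      by simp
    then have "P e - P 0 = I (- (e *\<^sub>R (?V (P e) + transpose (?V (P e)) + ?B1 + e *\<^sub>R (?W (P e) + ?B2))))"
      using left[of "P e - P 0"] by simp
    also have "\<dots> = e *\<^sub>R (F1 (P e) + (- I ?B1) + e *\<^sub>R (F2 (P e) + (- I ?B2)))"
      by (simp add: F1_def F2_def linear_add[OF I] linear_diff[OF I] linear_neg[OF I] linear_scale[OF I]
          scaleR_add_right scaleR_diff_right)
    finally show "P e - P 0 = e *\<^sub>R (F1 (P e) + (- I ?B1) + e *\<^sub>R (F2 (P e) + (- I ?B2)))" .
  qed
  from implicit_affine_derivative[OF F1 F2 this]
  have "(P has_vector_derivative F1 (P 0) + (- I ?B1)) (at 0)" .
  moreover have "F1 (P 0) + (- I ?B1) = I (- (Z + transpose Z))"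
    by (simp add: F1_def Z_def linear_add[OF I] linear_diff[OF I] linear_neg[OF I] transpose_linear_simps
        matrix_transpose_mul)
  ultimately show ?thesis
    using that[of "I (- (Z + transpose Z))"] right by simp
qed

text \<open>By symmetry the two occurrences of each of \<open>C\<close>, \<open>M\<^sub>j\<close> and \<open>P\<close> contribute equally. In \<open>K\<close> only the
  terms that are quadratic in \<open>P\<close> keep a factor \<open>2\<close>.\<close>

lemma gramian_cost_derivative:
  fixes C C' :: "real ^ 'n ^ 'p" and M M' :: "real ^ 'n ^ 'n ^ 'p" and P :: "real \<Rightarrow> real ^ 'n ^ 'n"
  assumes P: "(P has_vector_derivative D) (at 0)" and sym: "transpose (P 0) = P 0"
    and M: "\<And>j. transpose (M $ j) = M $ j"
  defines "K \<equiv> transpose C ** C + 2 *\<^sub>R (\<Sum>j\<in>UNIV. M $ j ** P 0 ** M $ j)"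
  shows "((\<lambda>e. gramian_cost (C + e *\<^sub>R C') (M + e *\<^sub>R M') (P e)) has_real_derivative
      K \<bullet> D + 2 * (C' \<bullet> (C ** P 0)) + 2 * (\<Sum>j\<in>UNIV. M' $ j \<bullet> (P 0 ** M $ j ** P 0))) (at 0)"
proof -
  note mult = bounded_bilinear.has_vector_derivative[OF bounded_bilinear_matrix_mult]
  note inner = bounded_bilinear.has_vector_derivative[OF bounded_bilinear_inner]
  have Cd: "((\<lambda>e. C + e *\<^sub>R C') has_vector_derivative C') (at 0)"
    by (auto intro!: derivative_eq_intros)
  have Md: "((\<lambda>e. (M + e *\<^sub>R M') $ j) has_vector_derivative M' $ j) (at 0)" for j
    by (auto intro!: derivative_eq_intros)
  have "((\<lambda>e. gramian_cost (C + e *\<^sub>R C') (M + e *\<^sub>R M') (P e)) has_vector_derivative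
      (C \<bullet> (C ** D + C' ** P 0) + C' \<bullet> (C ** P 0))
      + (\<Sum>j\<in>UNIV. M $ j \<bullet> (P 0 ** M $ j ** D + (P 0 ** M' $ j + D ** M $ j) ** P 0)
          + M' $ j \<bullet> (P 0 ** M $ j ** P 0))) (at 0)"
    unfolding gramian_cost_def
    using has_vector_derivative_add[OF inner[OF Cd mult[OF Cd P]]
        has_vector_derivative_sum[of UNIV, OF inner[OF Md mult[OF mult[OF P Md] P]]]]
    by simp
  moreover have "C \<bullet> (C ** D) = (transpose C ** C) \<bullet> D"
    by (rule inner_matrix_mult_left)
  moreover have "C \<bullet> (C' ** P 0) = C' \<bullet> (C ** P 0)"
    using inner_matrix_mult_right[of C C' "P 0"] sym by (simp add: inner_commute)
  moreover have "M $ j \<bullet> (P 0 ** M $ j ** D) = (M $ j ** P 0 ** M $ j) \<bullet> D" for j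
    using inner_matrix_mult_left[of "M $ j" "P 0 ** M $ j" D] sym M
    by (simp add: matrix_transpose_mul)
  moreover have "M $ j \<bullet> (D ** M $ j ** P 0) = (M $ j ** P 0 ** M $ j) \<bullet> D" for j
    using inner_matrix_mult_right[of "M $ j" D "M $ j ** P 0"] sym M
    by (simp add: matrix_transpose_mul matrix_mul_assoc)
  moreover have "M $ j \<bullet> (P 0 ** M' $ j ** P 0) = M' $ j \<bullet> (P 0 ** M $ j ** P 0)" for j
    using inner_matrix_mult_right[of "M $ j" "P 0 ** M' $ j" "P 0"]
      inner_matrix_mult_left[of "M $ j ** P 0" "P 0" "M' $ j"] sym
    by (simp add: matrix_mul_assoc inner_commute)
  ultimately show ?thesis
    by (simp add: has_real_derivative_iff_has_vector_derivative K_def inner_add_left inner_add_right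
        matrix_mult.add_left inner_sum_left sum.distrib sum_distrib_left algebra_simps)
qed

text \<open>The certificate persists along the line of systems, so the H2 norm there is the cost of the Gramian,
  whose derivative vanishes at the minimum. The derivative \<open>D\<close> of the Gramian enters as \<open>K \<bullet> D\<close>; the
  dual equation rewrites \<open>K\<close> through \<open>\<Theta>\<close>, and the adjoint moves the operator back to \<open>D\<close>, where its
  value is known.\<close>

theorem H2_first_order_condition:
  fixes A A' \<Theta> :: "real ^ 'n ^ 'n" and B B' :: "real ^ 'm ^ 'n" and C C' :: "real ^ 'n ^ 'p"
    and N N' :: "real ^ 'n ^ 'n ^ 'm" and M M' :: "real ^ 'n ^ 'n ^ 'p"
  assumes cert: "lyap_certificate A N Q"
    and M: "\<And>j. transpose (M $ j) = M $ j" and M': "\<And>j. transpose (M' $ j) = M' $ j"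
    and P: "lyap A N P + B ** transpose B = 0"
    and \<Theta>: "lyap (transpose A) (transposes N) \<Theta>
      + (transpose C ** C + 2 *\<^sub>R (\<Sum>j\<in>UNIV. M $ j ** P ** M $ j)) = 0"
    and min: "\<forall>\<^sub>F e in at 0. H2_norm_sq (A, B, C, N, M)
      \<le> H2_norm_sq (A + e *\<^sub>R A', B + e *\<^sub>R B', C + e *\<^sub>R C', N + e *\<^sub>R N', M + e *\<^sub>R M')"
  shows "\<Theta> \<bullet> (lyap_variation A' N N' P + B' ** transpose B) + C' \<bullet> (C ** P)
    + (\<Sum>j\<in>UNIV. M' $ j \<bullet> (P ** M $ j ** P)) = 0"
proof -
  let ?K = "transpose C ** C + 2 *\<^sub>R (\<Sum>j\<in>UNIV. M $ j ** P ** M $ j)"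
  let ?Z = "lyap_variation A' N N' P + B' ** transpose B"
  let ?A = "\<lambda>e. A + e *\<^sub>R A'" and ?B = "\<lambda>e. B + e *\<^sub>R B'" and ?C = "\<lambda>e. C + e *\<^sub>R C'"
    and ?N = "\<lambda>e. N + e *\<^sub>R N'" and ?M = "\<lambda>e. M + e *\<^sub>R M'"
  have Psym: "transpose P = P" by (rule psd_transpose[OF lyap_solution_psd[OF cert P]])
  have sol: "\<exists>P'. lyap (?A e) (?N e) P' + ?B e ** transpose (?B e) = 0"
    if cert_e: "lyap_certificate (?A e) (?N e) Q" for e
  proof -
    obtain P' where "lyap (?A e) (?N e) P' = - (?B e ** transpose (?B e))"
      using lyap_surj[OF cert_e] by blast
    then show ?thesis by (intro exI[of _ P']) simp
  qed
  \<comment> \<open>Where no certificate exists, the chosen value is meaningless, but certificates exist near \<open>0\<close>.\<close>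
  define G where "G e = (if e = 0 then P else SOME P'. lyap (?A e) (?N e) P' + ?B e ** transpose (?B e) = 0)" for e
  have G0: "G 0 = P" by (simp add: G_def)
  have ev: "\<forall>\<^sub>F e in at 0. lyap_certificate (?A e) (?N e) Q"
  proof (rule lyap_certificate_eventually[OF cert])
    have A: "((\<lambda>e. ?A e) \<longlongrightarrow> A + 0 *\<^sub>R A') (at 0)" by (intro tendsto_intros)
    have N: "((\<lambda>e. ?N e $ k) \<longlongrightarrow> (N + 0 *\<^sub>R N') $ k) (at 0)" for k by (intro tendsto_intros)
    have "((\<lambda>e. lyap (?A e) (?N e) Q) \<longlongrightarrow> lyap (A + 0 *\<^sub>R A') (N + 0 *\<^sub>R N') Q) (at 0)"
      unfolding sylvester_def
      by (intro tendsto_add tendsto_sum matrix_mult.tendsto tendsto_const A N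
          bounded_linear.tendsto[OF bounded_linear_transpose])
    then show "((\<lambda>e. lyap (?A e) (?N e) Q) \<longlongrightarrow> lyap A N Q) (at 0)" by simp
  qed
  have solves: "lyap (?A e) (?N e) (G e) + ?B e ** transpose (?B e) = 0"
    if "lyap_certificate (?A e) (?N e) Q" for e
    using someI_ex[OF sol[OF that]] P by (simp add: G_def)
  have "\<forall>\<^sub>F e in at 0. transpose (G e) = G e \<and>
      lyap (?A e) (?N e) (G e) + ?B e ** transpose (?B e) = 0"
    using ev
    by eventually_elim (use solves lyap_solution_psd psd_transpose in blast)
  then obtain D where D: "(G has_vector_derivative D) (at 0)" "lyap A N D = - (?Z + transpose ?Z)"
    using gramian_derivative[OF cert, of G B A' N' B'] P unfolding G0 by blast
  define \<phi> where "\<phi> e = gramian_cost (?C e) (?M e) (G e)" for e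
  have deriv: "(\<phi> has_real_derivative ?K \<bullet> D + 2 * (C' \<bullet> (C ** P))
      + 2 * (\<Sum>j\<in>UNIV. M' $ j \<bullet> (P ** M $ j ** P))) (at 0)"
    using gramian_cost_derivative[OF D(1) _ M, of C C' M'] Psym unfolding \<phi>_def G0 by simp
  have cost: "H2_norm_sq (?A e, ?B e, ?C e, ?N e, ?M e) = ennreal (\<phi> e)" "0 \<le> \<phi> e"
    if "lyap_certificate (?A e) (?N e) Q" for e
    using H2_norm_sq_eq_gramian_cost[OF that solves[OF that], of "?M e" "?C e"] M M'
    by (simp_all add: \<phi>_def transpose_linear_simps transpose_scalar)
  have "\<forall>\<^sub>F e in at 0. \<phi> 0 \<le> \<phi> e"
    using min ev
  proof eventually_elim
    fix e
    assume "H2_norm_sq (A, B, C, N, M) \<le> H2_norm_sq (?A e, ?B e, ?C e, ?N e, ?M e)"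
      and "lyap_certificate (?A e) (?N e) Q"
    then show "\<phi> 0 \<le> \<phi> e"
      using cost[of e] cost(1)[of 0] cert by (simp add: ennreal_le_iff)
  qed
  then obtain d where "d > 0" and d: "\<And>e. e \<noteq> 0 \<Longrightarrow> dist e 0 < d \<Longrightarrow> \<phi> 0 \<le> \<phi> e"
    unfolding eventually_at by auto
  have "\<forall>e. \<bar>0 - e\<bar> < d \<longrightarrow> \<phi> 0 \<le> \<phi> e"
  proof (intro allI impI)
    fix e assume "\<bar>0 - e\<bar> < d"
    then show "\<phi> 0 \<le> \<phi> e" using d[of e] by (cases "e = 0") (auto simp: dist_real_def)
  qed
  from DERIV_local_min[OF deriv \<open>d > 0\<close> this]
  have zero: "?K \<bullet> D + 2 * (C' \<bullet> (C ** P)) + 2 * (\<Sum>j\<in>UNIV. M' $ j \<bullet> (P ** M $ j ** P)) = 0" .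
  have "transpose ?K = ?K"
    by (simp add: transpose_linear_simps transpose_scalar matrix_transpose_mul M Psym matrix_mul_assoc)
  have L\<Theta>: "lyap (transpose A) (transposes N) \<Theta> = - ?K" using \<Theta> by (simp only: eq_neg_iff_add_eq_0)
  have "lyap (transpose A) (transposes N) (transpose \<Theta>) = lyap (transpose A) (transposes N) \<Theta>"
    unfolding transpose_sylvester[symmetric] L\<Theta> using \<open>transpose ?K = ?K\<close>
    by (simp only: transpose_linear_simps)
  then have \<Theta>sym: "transpose \<Theta> = \<Theta>" by (rule dual_lyap_inject[OF cert])
  have "?K \<bullet> D = - (lyap (transpose A) (transposes N) \<Theta> \<bullet> D)"
    by (simp only: L\<Theta> inner_minus_left minus_minus)
  also have "\<dots> = \<Theta> \<bullet> (?Z + transpose ?Z)"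
    by (simp only: sylvester_adjoint[symmetric] D(2) inner_minus_right minus_minus)
  also have "\<dots> = 2 * (\<Theta> \<bullet> ?Z)"
    using inner_transpose_left[of \<Theta> ?Z] \<Theta>sym by (simp only: inner_add_right)
  finally show ?thesis using zero by simp
qed

section \<open>Optimality conditions for the reduced system\<close>

text \<open>The error system is affine in the reduced system, so a line of reduced systems becomes a line of
  error systems.\<close>

lemma error_system_perturbed:
  "error_system (A, B, C, N, M) (Ah + e *\<^sub>R GA, Bh + e *\<^sub>R GB, Ch + e *\<^sub>R GC, Nh + e *\<^sub>R GN, Mh + e *\<^sub>R GM)
    = (blk A 0 0 Ah + e *\<^sub>R blk 0 0 0 GA, stack B Bh + e *\<^sub>R stack 0 GB,
       beside C (- Ch) + e *\<^sub>R beside 0 (- GC),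
       (\<chi> k. blk (N $ k) 0 0 (Nh $ k)) + e *\<^sub>R (\<chi> k. blk 0 0 0 (GN $ k)),
       (\<chi> j. blk (M $ j) 0 0 (- (Mh $ j))) + e *\<^sub>R (\<chi> j. blk 0 0 0 (- (GM $ j))))"
  by (simp add: error_system_def block_diag_eq_blk vec_eq_iff split_sum_all stack_def beside_def)

lemma locally_H2_optimal_direction:
  assumes opt: "locally_H2_optimal S (Ah, Bh, Ch, Nh, Mh)" and GM: "\<And>j. transpose (GM $ j) = GM $ j"
  shows "\<forall>\<^sub>F e in at 0. H2_norm_sq (error_system S (Ah, Bh, Ch, Nh, Mh))
    \<le> H2_norm_sq (error_system S (Ah + e *\<^sub>R GA, Bh + e *\<^sub>R GB, Ch + e *\<^sub>R GC, Nh + e *\<^sub>R GN, Mh + e *\<^sub>R GM))"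
proof -
  let ?S = "(Ah, Bh, Ch, Nh, Mh)"
  let ?T = "\<lambda>e. (Ah + e *\<^sub>R GA, Bh + e *\<^sub>R GB, Ch + e *\<^sub>R GC, Nh + e *\<^sub>R GN, Mh + e *\<^sub>R GM)"
  have Sh: "?S \<in> bqo_systems" using opt by (simp add: locally_H2_optimal_def)
  obtain d where d: "d > 0"
    "\<And>T. T \<in> bqo_systems \<Longrightarrow> T \<noteq> ?S \<Longrightarrow> dist T ?S < d
      \<Longrightarrow> H2_norm_sq (error_system S ?S) \<le> H2_norm_sq (error_system S T)"
    using opt unfolding locally_H2_optimal_def eventually_at by blast
  have T: "?T e \<in> bqo_systems" for e
    using Sh GM by (simp add: bqo_systems_def transpose_linear_simps transpose_scalar)
  have "(?T \<longlongrightarrow> ?T 0) (at 0)"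
    by (intro tendsto_intros)
  then have "(?T \<longlongrightarrow> ?S) (at 0)" by simp
  \<comment> \<open>A zero direction never leaves the reduced system itself, and there the inequality is trivial.\<close>
  from tendstoD[OF this d(1)] show ?thesis
  proof eventually_elim
    fix e assume "dist (?T e) ?S < d"
    then show "H2_norm_sq (error_system S ?S) \<le> H2_norm_sq (error_system S (?T e))"
      using d(2)[OF T[of e]] by (cases "?T e = ?S") auto
  qed
qed

theorem theorem5p1:
  fixes A :: "real ^ 'n ^ 'n" and B :: "real ^ 'm ^ 'n" and C :: "real ^ 'n ^ 'p"
    and N :: "real ^ 'n ^ 'n ^ 'm" and M :: "real ^ 'n ^ 'n ^ 'p"
    and Ah :: "real ^ 'r ^ 'r" and Bh :: "real ^ 'm ^ 'r" and Ch :: "real ^ 'r ^ 'p"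
    and Nh :: "real ^ 'r ^ 'r ^ 'm" and Mh :: "real ^ 'r ^ 'r ^ 'p"
    and \<alpha> \<beta> \<alpha>h \<beta>h :: real
    and Ph \<Psi> :: "real ^ 'r ^ 'r" and X \<Phi> :: "real ^ 'r ^ 'n"
  assumes "(A, B, C, N, M) \<in> bqo_systems" and "(Ah, Bh, Ch, Nh, Mh) \<in> bqo_systems"
    and "stable A" and "stable Ah"
    and "stability_params A \<alpha> \<beta>" and "stability_params Ah \<alpha>h \<beta>h"
    and "(spectral_norm (hcat N))\<^sup>2 < 2 * \<alpha> / \<beta>\<^sup>2"
    and "(spectral_norm (hcat (transposes N)))\<^sup>2 < 2 * \<alpha> / \<beta>\<^sup>2"
    and "(spectral_norm (hcat Nh))\<^sup>2 < 2 * \<alpha>h / \<beta>h\<^sup>2"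
    and "(spectral_norm (hcat (transposes Nh)))\<^sup>2 < 2 * \<alpha>h / \<beta>h\<^sup>2"
    and "locally_H2_optimal (A, B, C, N, M) (Ah, Bh, Ch, Nh, Mh)"
    and "Ah ** Ph + Ph ** transpose Ah
           + (\<Sum>k\<in>UNIV. Nh $ k ** Ph ** transpose (Nh $ k)) + Bh ** transpose Bh = 0"
    and "A ** X + X ** transpose Ah
           + (\<Sum>k\<in>UNIV. N $ k ** X ** transpose (Nh $ k)) + B ** transpose Bh = 0"
    and "transpose \<Psi> = \<Psi>"
    and "transpose Ah ** \<Psi> + \<Psi> ** Ah
           + (\<Sum>k\<in>UNIV. transpose (Nh $ k) ** \<Psi> ** Nh $ k)
           + 2 *\<^sub>R (\<Sum>j\<in>UNIV. Mh $ j ** Ph ** Mh $ j) + transpose Ch ** Ch = 0"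
    and "transpose A ** \<Phi> + \<Phi> ** Ah
           + (\<Sum>k\<in>UNIV. transpose (N $ k) ** \<Phi> ** Nh $ k)
           + 2 *\<^sub>R (\<Sum>j\<in>UNIV. M $ j ** X ** Mh $ j) + transpose C ** Ch = 0"
  shows "0 = \<Psi> ** Ph - transpose \<Phi> ** X
       \<and> 0 = \<Psi> ** Bh - transpose \<Phi> ** B
       \<and> (\<forall>k. 0 = \<Psi> ** Nh $ k ** Ph - transpose \<Phi> ** N $ k ** X)
       \<and> 0 = Ch ** Ph - C ** X
       \<and> (\<forall>j. 0 = Ph ** Mh $ j ** Ph - transpose X ** M $ j ** X)"
proof -
  note opt = assms(11)
  have Ph: "lyap Ah Nh Ph + Bh ** transpose Bh = 0"
    and X: "sylvester A Ah N Nh X + B ** transpose Bh = 0"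
    using assms(12,13) by (simp_all add: sylvester_def)
  have \<Psi>: "lyap (transpose Ah) (transposes Nh) \<Psi>
      + (transpose Ch ** Ch + 2 *\<^sub>R (\<Sum>j\<in>UNIV. Mh $ j ** Ph ** Mh $ j)) = 0"
    and \<Phi>: "sylvester (transpose A) (transpose Ah) (transposes N) (transposes Nh) \<Phi>
      + (transpose C ** Ch + 2 *\<^sub>R (\<Sum>j\<in>UNIV. M $ j ** X ** Mh $ j)) = 0"
    using assms(15,16) by (simp_all add: sylvester_def transposes_def add_ac)
  have M: "transpose (M $ j) = M $ j" and Mh: "transpose (Mh $ j) = Mh $ j" for j
    using assms(1,2) by (simp_all add: bqo_systems_def)
  obtain Q where Q: "lyap_certificate A N Q"
    using lyap_certificate_exists[OF assms(5,7)] by blast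
  obtain Qh where Qh: "lyap_certificate Ah Nh Qh"
    using lyap_certificate_exists[OF assms(6,9)] by blast
  \<comment> \<open>The Gramian and the dual solution of the error system need upper left blocks, too.\<close>
  obtain P where P: "lyap A N P = - (B ** transpose B)"
    using lyap_surj[OF Q] by blast
  obtain \<Theta> where \<Theta>: "lyap (transpose A) (transposes N) \<Theta>
      = - (transpose C ** C + 2 *\<^sub>R (\<Sum>j\<in>UNIV. M $ j ** P ** M $ j))"
    using dual_lyap_surj[OF Q] by blast
  have Ph_sym: "transpose Ph = Ph"
    by (rule psd_transpose[OF lyap_solution_psd[OF Qh Ph]])

  \<comment> \<open>The direction of variation: the five matrices that have to vanish. The signs of \<open>GC\<close> and \<open>GM\<close> in the
     error system are those of \<open>- Ch\<close> and \<open>- Mh\<close>.\<close>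
  define GA where "GA = \<Psi> ** Ph - transpose \<Phi> ** X"
  define GB where "GB = \<Psi> ** Bh - transpose \<Phi> ** B"
  define GN where "GN = (\<chi> k. \<Psi> ** Nh $ k ** Ph - transpose \<Phi> ** N $ k ** X)"
  define GC where "GC = Ch ** Ph - C ** X"
  define GM where "GM = (\<chi> j. Ph ** Mh $ j ** Ph - transpose X ** M $ j ** X)"
  have GM_sym: "transpose (GM $ j) = GM $ j" for j
    by (simp add: GM_def transpose_linear_simps matrix_transpose_mul M Mh Ph_sym matrix_mul_assoc)

  define Ae where "Ae = blk A 0 0 Ah"
  define Ne where "Ne = (\<chi> k. blk (N $ k) 0 0 (Nh $ k))"
  define Be where "Be = stack B Bh"
  define Ce where "Ce = beside C (- Ch)"
  define Me where "Me = (\<chi> j. blk (M $ j) 0 0 (- (Mh $ j)))"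
  define Pe where "Pe = blk P X (transpose X) Ph"
  define \<Theta>e where "\<Theta>e = blk \<Theta> (- \<Phi>) (- transpose \<Phi>) \<Psi>"
  have "sylvester Ah A Nh N (transpose X) = transpose (sylvester A Ah N Nh X)"
    by (rule transpose_sylvester[symmetric])
  also have "\<dots> = - (Bh ** transpose B)"
    using X by (simp add: eq_neg_iff_add_eq_0[symmetric] transpose_linear_simps matrix_transpose_mul)
  finally have XT: "sylvester Ah A Nh N (transpose X) + Bh ** transpose B = 0" by simp
  have Pe: "lyap Ae Ne Pe + Be ** transpose Be = 0"
    unfolding Ae_def Ne_def Pe_def Be_def sylvester_blk stack_mult_transpose blk_linear blk_eq_0_iff
    by (simp add: P X XT Ph)

  have duals: "transposes Ne = (\<chi> k. blk (transposes N $ k) 0 0 (transposes Nh $ k))"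
    by (simp add: Ne_def transposes_def blk_transpose transpose_linear_simps)
  let ?R = "transpose C ** Ch + 2 *\<^sub>R (\<Sum>j\<in>UNIV. M $ j ** X ** Mh $ j)"
  have "sylvester (transpose Ah) (transpose A) (transposes Nh) (transposes N) (transpose \<Phi>)
      = transpose (sylvester (transpose A) (transpose Ah) (transposes N) (transposes Nh) \<Phi>)"
    by (rule transpose_sylvester[symmetric])
  also have "\<dots> = - transpose ?R"
    using \<Phi> by (simp only: eq_neg_iff_add_eq_0[symmetric] transpose_linear_simps)
  finally have \<Phi>T: "sylvester (transpose Ah) (transpose A) (transposes Nh) (transposes N) (- transpose \<Phi>)
      = transpose ?R"
    by (simp only: linear_neg[OF linear_sylvester] minus_minus)
  have \<Phi>N: "sylvester (transpose A) (transpose Ah) (transposes N) (transposes Nh) (- \<Phi>) = ?R"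
    using \<Phi> by (simp only: linear_neg[OF linear_sylvester] eq_neg_iff_add_eq_0[symmetric] minus_minus)
  have K: "transpose Ce ** Ce + 2 *\<^sub>R (\<Sum>j\<in>UNIV. Me $ j ** Pe ** Me $ j)
      = blk (transpose C ** C + 2 *\<^sub>R (\<Sum>j\<in>UNIV. M $ j ** P ** M $ j)) (- ?R) (- transpose ?R)
          (transpose Ch ** Ch + 2 *\<^sub>R (\<Sum>j\<in>UNIV. Mh $ j ** Ph ** Mh $ j))"
    by (simp add: Ce_def Me_def Pe_def transpose_mult_beside blk_mult blk_linear
        transpose_linear_simps transpose_scalar matrix_transpose_mul M Mh matrix_mul_assoc
        matrix_mult.minus_left matrix_mult.minus_right sum_negf)
  have \<Theta>e: "lyap (transpose Ae) (transposes Ne) \<Theta>e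
      + (transpose Ce ** Ce + 2 *\<^sub>R (\<Sum>j\<in>UNIV. Me $ j ** Pe ** Me $ j)) = 0"
    unfolding K duals Ae_def blk_transpose transpose_linear_simps \<Theta>e_def sylvester_blk blk_linear
      blk_eq_0_iff \<Theta> \<Phi>N \<Phi>T
    using \<Psi> by simp

  have zero: "\<Theta>e \<bullet> (lyap_variation (blk 0 0 0 GA) Ne (\<chi> k. blk 0 0 0 (GN $ k)) Pe + stack 0 GB ** transpose Be)
      + beside 0 (- GC) \<bullet> (Ce ** Pe)
      + (\<Sum>j\<in>UNIV. (\<chi> j. blk 0 0 0 (- (GM $ j))) $ j \<bullet> (Pe ** Me $ j ** Pe)) = 0"
  proof (rule H2_first_order_condition[OF _ _ _ Pe \<Theta>e])
    show "lyap_certificate Ae Ne (blk Q 0 0 Qh)"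
      unfolding Ae_def Ne_def by (rule lyap_certificate_blk[OF Q Qh])
    show "transpose (Me $ j) = Me $ j" for j
      by (simp add: Me_def blk_transpose transpose_linear_simps M Mh)
    show "transpose ((\<chi> j. blk 0 0 0 (- (GM $ j))) $ j)
        = ((\<chi> j. blk 0 0 0 (- (GM $ j))) :: real ^ ('n + 'r) ^ ('n + 'r) ^ 'p) $ j" for j
      by (simp add: blk_transpose transpose_linear_simps GM_sym)
    show "\<forall>\<^sub>F e in at 0. H2_norm_sq (Ae, Be, Ce, Ne, Me)
        \<le> H2_norm_sq (Ae + e *\<^sub>R blk 0 0 0 GA, Be + e *\<^sub>R stack 0 GB, Ce + e *\<^sub>R beside 0 (- GC),
            Ne + e *\<^sub>R (\<chi> k. blk 0 0 0 (GN $ k)), Me + e *\<^sub>R (\<chi> j. blk 0 0 0 (- (GM $ j))))"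
      \<comment> \<open>The second fact, a perturbation by zero, brings the unperturbed error system into the same form.\<close>
      using locally_H2_optimal_direction[OF opt GM_sym, of GA GB GC GN]
        error_system_perturbed[of A B C N M Ah 0 0 Bh 0 Ch 0 Nh 0 Mh 0]
      by (simp add: error_system_perturbed Ae_def Be_def Ce_def Ne_def Me_def)
  qed
  \<comment> \<open>The direction only has a lower block row, so of the dual solution only \<open>- transpose \<Phi>\<close> and \<open>\<Psi>\<close> matter.\<close>
  have lower_row: "\<Theta>e \<bullet> blk 0 0 (G ** transpose Y) (G ** transpose Z)
      = (\<Psi> ** Z - transpose \<Phi> ** Y) \<bullet> G" for G :: "real ^ 'k ^ 'r" and Y Z
    using inner_matrix_mult_right[of "- transpose \<Phi>" G "transpose Y"]
      inner_matrix_mult_right[of \<Psi> G "transpose Z"]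
    by (simp add: \<Theta>e_def blk_inner inner_diff_left matrix_mult.minus_left)
  have drift: "\<Theta>e \<bullet> (blk 0 0 0 GA ** Pe) = GA \<bullet> GA"
    using lower_row[of GA X Ph] Ph_sym by (simp add: Pe_def blk_mult GA_def)
  have bil: "\<Theta>e \<bullet> (blk 0 0 0 (GN $ k) ** Pe ** transpose (Ne $ k)) = GN $ k \<bullet> GN $ k" for k
    using lower_row[of "GN $ k" "N $ k ** X" "Nh $ k ** Ph"] Ph_sym
    by (simp add: Pe_def Ne_def blk_mult blk_transpose transpose_linear_simps matrix_transpose_mul
        matrix_mul_assoc GN_def)
  have input: "\<Theta>e \<bullet> (stack 0 GB ** transpose Be) = GB \<bullet> GB"
    using lower_row[of GB B Bh] by (simp add: Be_def stack_mult_transpose GB_def)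
  have outp: "beside 0 (- GC) \<bullet> (Ce ** Pe) = GC \<bullet> GC"
    by (simp add: Ce_def Pe_def beside_mult_blk beside_inner GC_def matrix_mult.minus_left inner_diff_right inner_diff_left algebra_simps)
  have quad: "blk 0 0 0 (- (GM $ j)) \<bullet> (Pe ** Me $ j ** Pe) = GM $ j \<bullet> GM $ j" for j
  proof -
    have GM_j: "transpose X ** M $ j ** X - Ph ** Mh $ j ** Ph = - (GM $ j)"
      by (simp add: GM_def)
    have "blk 0 0 0 (- (GM $ j)) \<bullet> (Pe ** Me $ j ** Pe)
        = - (GM $ j) \<bullet> (transpose X ** M $ j ** X - Ph ** Mh $ j ** Ph)"
      by (simp add: Pe_def Me_def blk_mult blk_inner matrix_mult.minus_left matrix_mult.minus_right)
    also have "\<dots> = GM $ j \<bullet> GM $ j"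
      unfolding GM_j by simp
    finally show ?thesis .
  qed
  have squares: "GA \<bullet> GA + (\<Sum>k\<in>UNIV. GN $ k \<bullet> GN $ k) + GB \<bullet> GB + GC \<bullet> GC
      + (\<Sum>j\<in>UNIV. GM $ j \<bullet> GM $ j) = 0"
    using zero by (simp add: lyap_variation_def inner_add_right inner_sum_right drift bil input outp quad)
  have "0 \<le> GA \<bullet> GA" "0 \<le> (\<Sum>k\<in>UNIV. GN $ k \<bullet> GN $ k)" "0 \<le> GB \<bullet> GB" "0 \<le> GC \<bullet> GC"
    "0 \<le> (\<Sum>j\<in>UNIV. GM $ j \<bullet> GM $ j)"
    by (simp_all add: sum_nonneg)
  with squares have "GA \<bullet> GA = 0" "(\<Sum>k\<in>UNIV. GN $ k \<bullet> GN $ k) = 0" "GB \<bullet> GB = 0" "GC \<bullet> GC = 0"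
    "(\<Sum>j\<in>UNIV. GM $ j \<bullet> GM $ j) = 0"
    by linarith+
  then have "GA = 0" "GB = 0" "GC = 0" "\<And>k. GN $ k = 0" "\<And>j. GM $ j = 0"
    by (simp_all add: sum_nonneg_eq_0_iff)
  then show ?thesis
    by (simp add: GA_def GB_def GC_def GN_def GM_def)
qed

end
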